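(* Let $W$ be an $\omega$-Stone space. Then the following are equivalent: (a) $W$ is primitive; (b) $W$ admits a rank partition; (c) the orbit diagram of $W$ forms a rank partition.
   Context: A PO system is a set $P$ with an antisymmetric transitive relation $<$ (possibly $p<p$ for some $p$); $p\leqslant q$ means $p<q$ or $p=q$; $p\lneqq q$ means $p\leqslant q$ and $p\neq q$. Suprema are with respect to $\leqslant$, and strictly increasing is with respect to $\lneqq$. An element of $P$ is separated if it is not the supremum of a strictly increasing sequence in $P$. A Stone space $W$ is a locally compact Hausdorff space with a base of compact open sets (the Stone space of a Boolean ring, possibly without $1$); it is an $\omega$-Stone space if $R=\mathrm{Co}(W)$, the Boolean ring of compact open subsets, is countable. For $A\in R$ let $(A)=\{C\in R: C\subseteq A\}$; $A$ is pseudo-indecomposable (PI) if for all $B\in R$ with $B\subseteq A$, $(B)\cong(A)$ or $(A-B)\cong(A)$. $W$ is primitive if every element of $R$ is the disjoint union of finitely many PI elements. A complete $P$-partition $\mathscr{X}=\{X_p\mid p\in P\}$ of $W$ is a partition of $W$ into non-empty sets $X_p$ with $X_p'=\bigcup_{q<p}X_q$ for all $p\in P$, where $S'$ is the set of limit points of $S$; its label function is $\tau\colon W\to P$, $\tau(w)=p$ for $w\in X_p$. It is a rank $P$-partition if: (RP1) if $q$ is separated, $x=\lim x_k$, $\tau(x)\geqslant q$ and $\{\tau(x_k)\mid k\geqslant1\}$ are either pairwise strictly incomparable or strictly increasing, then $\tau(x_k)\geqslant q$ for all but finitely many $k$; (RP2) if $\tau(x)$ is not separated, then $x=\lim x_k$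 for some $x_k$ with $\tau(x_k)\lneqq\tau(x)$ for all $k$. A rank partition is a rank $P$-partition for some PO system $P$. The orbit diagram of $W$ is $\mathscr{O}(W)=\{[w]\mid w\in W\}$, where $[w]$ is the orbit of $w$ under homeomorphisms $W\to W$, with the relation $[w]<[x]$ iff some point in $[w]$ is a limit of distinct points in $[x]$; statement (c) means that, with this relation as index PO system, the orbits form a rank $\mathscr{O}(W)$-partition of $W$. *)

theory Defs
  imports "HOL-Analysis.Analysis" "HOL-Algebra.QuotRing"
begin

text \<open>The relation is only ever evaluated on the carrier \<open>P\<close>. It is neither assumed
  reflexive nor irreflexive: \<open>lt p p\<close> may hold for some \<open>p\<close> and fail for others.\<close>

definition po_system :: "'p set \<Rightarrow> ('p \<Rightarrow> 'p \<Rightarrow> bool) \<Rightarrow> bool" where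
  "po_system P lt \<longleftrightarrow> antisymp_on P lt \<and> transp_on P lt"

definition po_le :: "('p \<Rightarrow> 'p \<Rightarrow> bool) \<Rightarrow> 'p \<Rightarrow> 'p \<Rightarrow> bool" where
  "po_le lt p q \<longleftrightarrow> lt p q \<or> p = q"

definition po_lneq :: "('p \<Rightarrow> 'p \<Rightarrow> bool) \<Rightarrow> 'p \<Rightarrow> 'p \<Rightarrow> bool" where
  "po_lneq lt p q \<longleftrightarrow> po_le lt p q \<and> p \<noteq> q"

definition strictly_incomparable :: "('p \<Rightarrow> 'p \<Rightarrow> bool) \<Rightarrow> 'p \<Rightarrow> 'p \<Rightarrow> bool" where
  "strictly_incomparable lt p q \<longleftrightarrow> \<not> po_le lt p q \<and> \<not> po_le lt q p"

definition strictly_increasing :: "('p \<Rightarrow> 'p \<Rightarrow> bool) \<Rightarrow> (nat \<Rightarrow> 'p) \<Rightarrow> bool" where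
  "strictly_increasing lt s \<longleftrightarrow> monotone (<) (po_lneq lt) s"

definition is_supremum :: "'p set \<Rightarrow> ('p \<Rightarrow> 'p \<Rightarrow> bool) \<Rightarrow> 'p set \<Rightarrow> 'p \<Rightarrow> bool" where
  "is_supremum P lt S p \<longleftrightarrow>
     p \<in> P \<and> (\<forall>s\<in>S. po_le lt s p) \<and> (\<forall>u\<in>P. (\<forall>s\<in>S. po_le lt s u) \<longrightarrow> po_le lt p u)"

definition separated_in :: "'p set \<Rightarrow> ('p \<Rightarrow> 'p \<Rightarrow> bool) \<Rightarrow> 'p \<Rightarrow> bool" where
  "separated_in P lt p \<longleftrightarrow>
     p \<in> P \<and>
     \<not> (\<exists>s :: nat \<Rightarrow> 'p. range s \<subseteq> P \<and> strictly_increasing lt s \<and> is_supremum P lt (range s) p)"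

definition stone_space :: "'a topology \<Rightarrow> bool" where
  "stone_space W \<longleftrightarrow>
     locally_compact_space W \<and> Hausdorff_space W \<and>
     (\<exists>\<B>. (\<forall>V\<in>\<B>. openin W V \<and> compactin W V) \<and>
          (\<forall>U x. openin W U \<and> x \<in> U \<longrightarrow> (\<exists>V\<in>\<B>. x \<in> V \<and> V \<subseteq> U)))"

definition Co :: "'a topology \<Rightarrow> 'a set set" where
  "Co W = {A. openin W A \<and> compactin W A}"

definition omega_stone_space :: "'a topology \<Rightarrow> bool" where
  "omega_stone_space W \<longleftrightarrow> stone_space W \<and> countable (Co W)"

definition principal_ring :: "'a topology \<Rightarrow> 'a set \<Rightarrow> 'a set ring" where
  "principal_ring W A =
     \<lparr>carrier = {C \<in> Co W. C \<subseteq> A}, monoid.mult = (\<inter>), one = A, zero = {}, add = sym_diff\<rparr>"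

definition pseudo_indecomposable :: "'a topology \<Rightarrow> 'a set \<Rightarrow> bool" where
  "pseudo_indecomposable W A \<longleftrightarrow>
     A \<in> Co W \<and>
     (\<forall>B\<in>Co W. B \<subseteq> A \<longrightarrow>
        principal_ring W B \<simeq> principal_ring W A \<or>
        principal_ring W (A - B) \<simeq> principal_ring W A)"

definition primitive_space :: "'a topology \<Rightarrow> bool" where
  "primitive_space W \<longleftrightarrow>
     (\<forall>A\<in>Co W. \<exists>\<F>. finite \<F> \<and> pairwise disjnt \<F> \<and> \<Union>\<F> = A \<and>
        (\<forall>B\<in>\<F>. pseudo_indecomposable W B))"

definition complete_partition ::
    "'a topology \<Rightarrow> 'p set \<Rightarrow> ('p \<Rightarrow> 'p \<Rightarrow> bool) \<Rightarrow> ('p \<Rightarrow> 'a set) \<Rightarrow> bool" where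
  "complete_partition W P lt X \<longleftrightarrow>
     po_system P lt \<and>
     (\<forall>p\<in>P. X p \<noteq> {}) \<and> disjoint_family_on X P \<and> (\<Union>p\<in>P. X p) = topspace W \<and>
     (\<forall>p\<in>P. W derived_set_of (X p) = (\<Union>q\<in>{q\<in>P. lt q p}. X q))"

definition part_label :: "'p set \<Rightarrow> ('p \<Rightarrow> 'a set) \<Rightarrow> 'a \<Rightarrow> 'p" where
  "part_label P X w = (THE p. p \<in> P \<and> w \<in> X p)"

definition RP1 ::
    "'a topology \<Rightarrow> 'p set \<Rightarrow> ('p \<Rightarrow> 'p \<Rightarrow> bool) \<Rightarrow> ('a \<Rightarrow> 'p) \<Rightarrow> bool" where
  "RP1 W P lt \<tau> \<longleftrightarrow>
     (\<forall>q x xs. separated_in P lt q \<and> x \<in> topspace W \<and> range xs \<subseteq> topspace W \<and>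
        limitin W xs x sequentially \<and> po_le lt q (\<tau> x) \<and>
        ((\<forall>j k. j \<noteq> k \<longrightarrow> strictly_incomparable lt (\<tau> (xs j)) (\<tau> (xs k))) \<or>
         strictly_increasing lt (\<lambda>k. \<tau> (xs k)))
        \<longrightarrow> (\<forall>\<^sub>F k in sequentially. po_le lt q (\<tau> (xs k))))"

definition RP2 ::
    "'a topology \<Rightarrow> 'p set \<Rightarrow> ('p \<Rightarrow> 'p \<Rightarrow> bool) \<Rightarrow> ('a \<Rightarrow> 'p) \<Rightarrow> bool" where
  "RP2 W P lt \<tau> \<longleftrightarrow>
     (\<forall>x\<in>topspace W. \<not> separated_in P lt (\<tau> x) \<longrightarrow>
        (\<exists>xs. range xs \<subseteq> topspace W \<and> limitin W xs x sequentially \<and>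
              (\<forall>k. po_lneq lt (\<tau> (xs k)) (\<tau> x))))"

definition rank_partition ::
    "'a topology \<Rightarrow> 'p set \<Rightarrow> ('p \<Rightarrow> 'p \<Rightarrow> bool) \<Rightarrow> ('p \<Rightarrow> 'a set) \<Rightarrow> bool" where
  "rank_partition W P lt X \<longleftrightarrow>
     complete_partition W P lt X \<and>
     RP1 W P lt (part_label P X) \<and> RP2 W P lt (part_label P X)"

text \<open>The index type is fixed to \<open>'a set\<close> here because HOL cannot quantify over types inside a
  formula. This loses nothing: the parts are non-empty and disjoint, so any index system embeds
  into the sets of points; see \<open>admits_rank_partitionI\<close> below for an arbitrary index type.\<close>

definition admits_rank_partition :: "'a topology \<Rightarrow> bool" where
  "admits_rank_partition W \<longleftrightarrow>
     (\<exists>(P :: 'a set set) lt X. rank_partition W P lt X)"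

lemma part_label_eq:
  assumes "disjoint_family_on X P" "p \<in> P" "w \<in> X p"
  shows "part_label P X w = p"
  unfolding part_label_def
  using assms by (intro the_equality) (auto simp: disjoint_family_on_def)

lemma admits_rank_partitionI:
  fixes P :: "'p set" and W :: "'a topology"
  assumes rp: "rank_partition W P lt X"
  shows "admits_rank_partition W"
proof -
  have po: "po_system P lt" and ne: "\<And>p. p \<in> P \<Longrightarrow> X p \<noteq> {}" and dj: "disjoint_family_on X P"
    and un: "(\<Union>p\<in>P. X p) = topspace W"
    and der: "\<And>p. p \<in> P \<Longrightarrow> W derived_set_of (X p) = (\<Union>q\<in>{q\<in>P. lt q p}. X q)"
    and rp1: "RP1 W P lt (part_label P X)" and rp2: "RP2 W P lt (part_label P X)"
    using rp by (auto simp: rank_partition_def complete_partition_def)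
  define g where "g = inv_into P X"
  define Q where "Q = X ` P"
  define lt' where "lt' U V = lt (g U) (g V)" for U V
  have inj: "inj_on X P"
    using ne dj by (fastforce simp: inj_on_def disjoint_family_on_def)
  have gX [simp]: "g (X p) = p" if "p \<in> P" for p
    using inj that by (simp add: g_def)
  have Xg [simp]: "X (g U) = U" and gP: "g U \<in> P" if "U \<in> Q" for U
    using that by (auto simp: Q_def)
  have g_eq: "g U = g V \<longleftrightarrow> U = V" if "U \<in> Q" "V \<in> Q" for U V
    using that Xg by metis
  have le: "po_le lt' U V = po_le lt (g U) (g V)" if "U \<in> Q" "V \<in> Q" for U V
    using g_eq that by (simp add: po_le_def lt'_def)
  have lneq: "po_lneq lt' U V = po_lneq lt (g U) (g V)" if "U \<in> Q" "V \<in> Q" for U V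
    using g_eq le that by (simp add: po_lneq_def)
  have QP: "X p \<in> Q" if "p \<in> P" for p using that by (simp add: Q_def)
  have dj': "disjoint_family_on (\<lambda>U. U) Q"
    unfolding disjoint_family_on_def
  proof (intro ballI impI)
    fix U V assume UV: "U \<in> Q" "V \<in> Q" "U \<noteq> V"
    then have "X (g U) \<inter> X (g V) = {}"
      using dj gP g_eq by (simp add: disjoint_family_on_def del: Xg)
    then show "U \<inter> V = {}" using UV by simp
  qed
  have lab: "part_label P X w \<in> P" "part_label Q (\<lambda>U. U) w \<in> Q"
    "g (part_label Q (\<lambda>U. U) w) = part_label P X w" if w: "w \<in> topspace W" for w
  proof -
    obtain p where p: "p \<in> P" "w \<in> X p" using w un by blast
    have "part_label P X w = p" using part_label_eq[OF dj] p by simp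
    moreover have "part_label Q (\<lambda>U. U) w = X p"
      using part_label_eq[OF dj', of "X p"] p QP by simp
    ultimately show "part_label P X w \<in> P" "part_label Q (\<lambda>U. U) w \<in> Q"
      "g (part_label Q (\<lambda>U. U) w) = part_label P X w"
      using p QP by auto
  qed
  have incr: "strictly_increasing lt' s = strictly_increasing lt (\<lambda>k. g (s k))"
    if "range s \<subseteq> Q" for s
    using that lneq by (simp add: strictly_increasing_def monotone_on_def subset_eq)
  have sup: "is_supremum Q lt' (range s) U = is_supremum P lt (range (\<lambda>k. g (s k))) (g U)"
    if "range s \<subseteq> Q" "U \<in> Q" for s :: "nat \<Rightarrow> 'a set" and U
  proof -
    have "(\<forall>u\<in>Q. (\<forall>k. po_le lt' (s k) u) \<longrightarrow> po_le lt' U u) =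
          (\<forall>u\<in>Q. (\<forall>k. po_le lt (g (s k)) (g u)) \<longrightarrow> po_le lt (g U) (g u))"
      using that le by (auto simp: subset_eq)
    also have "\<dots> = (\<forall>u\<in>P. (\<forall>k. po_le lt (g (s k)) u) \<longrightarrow> po_le lt (g U) u)"
      by (auto simp: Q_def)
    finally show ?thesis
      using that le gP by (simp add: is_supremum_def subset_eq)
  qed
  have sep: "separated_in Q lt' U = separated_in P lt (g U)" if U: "U \<in> Q" for U
  proof -
    have "(\<exists>s. range s \<subseteq> Q \<and> strictly_increasing lt' s \<and> is_supremum Q lt' (range s) U) =
          (\<exists>s. range s \<subseteq> P \<and> strictly_increasing lt s \<and> is_supremum P lt (range s) (g U))"
      (is "?L = ?R")
    proof
      assume ?L
      then obtain s where s: "range s \<subseteq> Q" "strictly_increasing lt' s"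
        "is_supremum Q lt' (range s) U" by blast
      then have "range (\<lambda>k. g (s k)) \<subseteq> P" using gP by auto
      then show ?R using s incr sup U by blast
    next
      assume ?R
      then obtain s where s: "range s \<subseteq> P" "strictly_increasing lt s"
        "is_supremum P lt (range s) (g U)" by blast
      have r: "range (\<lambda>k. X (s k)) \<subseteq> Q" using s(1) QP by auto
      have e: "(\<lambda>k. g (X (s k))) = s" using s(1) by (auto simp: subset_eq)
      show ?L
        using r s incr[OF r] sup[OF r U] unfolding e by blast
    qed
    then show ?thesis using U gP by (simp add: separated_in_def)
  qed
  have po': "po_system Q lt'"
    unfolding po_system_def
  proof
    show "antisymp_on Q lt'"
      using po gP g_eq unfolding po_system_def antisymp_on_def lt'_def by metis
    show "transp_on Q lt'"
      using po gP unfolding po_system_def transp_on_def lt'_def by metis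
  qed
  have cp: "complete_partition W Q lt' (\<lambda>U. U)"
    unfolding complete_partition_def
  proof (intro conjI ballI)
    show "po_system Q lt'" by (fact po')
    show "disjoint_family_on (\<lambda>U. U) Q" by (fact dj')
    show "(\<Union>U\<in>Q. U) = topspace W" using un by (simp add: Q_def)
    show "U \<noteq> {}" if "U \<in> Q" for U using that ne by (auto simp: Q_def)
    show "W derived_set_of U = (\<Union>V\<in>{V\<in>Q. lt' V U}. V)" if "U \<in> Q" for U
    proof -
      obtain p where p: "p \<in> P" "U = X p" using \<open>U \<in> Q\<close> by (auto simp: Q_def)
      have "{V\<in>Q. lt' V U} = X ` {q\<in>P. lt q p}"
        using p by (auto simp: Q_def lt'_def)
      then show ?thesis using der p by simp
    qed
  qed
  let ?t = "part_label P X" and ?t' = "part_label Q (\<lambda>U. U)"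
  have r1: "RP1 W Q lt' ?t'"
    unfolding RP1_def
  proof (intro allI impI, elim conjE)
    fix U x and xs :: "nat \<Rightarrow> 'a"
    assume s: "separated_in Q lt' U" and x: "x \<in> topspace W" and xs: "range xs \<subseteq> topspace W"
      and lim: "limitin W xs x sequentially" and leU: "po_le lt' U (?t' x)"
      and alt: "(\<forall>j k. j \<noteq> k \<longrightarrow> strictly_incomparable lt' (?t' (xs j)) (?t' (xs k))) \<or>
         strictly_increasing lt' (\<lambda>k. ?t' (xs k))"
    have U: "U \<in> Q" using s by (simp add: separated_in_def)
    have xk: "xs k \<in> topspace W" for k using xs by auto
    have rk: "range (\<lambda>k. ?t' (xs k)) \<subseteq> Q" using lab(2) xk by auto
    have "separated_in P lt (g U)" using s sep U by simp
    moreover have "po_le lt (g U) (?t x)" using leU le U lab x by simp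
    moreover have "(\<forall>j k. j \<noteq> k \<longrightarrow> strictly_incomparable lt (?t (xs j)) (?t (xs k))) \<or>
         strictly_increasing lt (\<lambda>k. ?t (xs k))"
      using alt unfolding incr[OF rk] by (simp add: strictly_incomparable_def le lab xk)
    ultimately have "\<forall>\<^sub>F k in sequentially. po_le lt (g U) (?t (xs k))"
      using rp1 x xs lim unfolding RP1_def by blast
    then show "\<forall>\<^sub>F k in sequentially. po_le lt' U (?t' (xs k))"
      by (simp add: le U lab xk)
  qed
  have r2: "RP2 W Q lt' ?t'"
    unfolding RP2_def
  proof (intro ballI impI)
    fix x assume x: "x \<in> topspace W" and s: "\<not> separated_in Q lt' (?t' x)"
    then have "\<not> separated_in P lt (?t x)" using sep lab by simp
    then obtain xs where xs: "range xs \<subseteq> topspace W" "limitin W xs x sequentially"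
      "\<forall>k. po_lneq lt (?t (xs k)) (?t x)"
      using rp2 x unfolding RP2_def by blast
    have "\<forall>k. po_lneq lt' (?t' (xs k)) (?t' x)"
      using xs x by (simp add: lneq lab subset_eq)
    then show "\<exists>xs. range xs \<subseteq> topspace W \<and> limitin W xs x sequentially \<and>
              (\<forall>k. po_lneq lt' (?t' (xs k)) (?t' x))"
      using xs by blast
  qed
  show ?thesis
    unfolding admits_rank_partition_def rank_partition_def using cp r1 r2 by blast
qed

definition homeo_orbit :: "'a topology \<Rightarrow> 'a \<Rightarrow> 'a set" where
  "homeo_orbit W w = {h w | h. homeomorphic_map W W h}"

definition orbit_diagram :: "'a topology \<Rightarrow> 'a set set" where
  "orbit_diagram W = homeo_orbit W ` topspace W"

definition orbit_less :: "'a topology \<Rightarrow> 'a set \<Rightarrow> 'a set \<Rightarrow> bool" where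
  "orbit_less W U V \<longleftrightarrow>
     (\<exists>y\<in>U. \<exists>ys :: nat \<Rightarrow> 'a. inj ys \<and> range ys \<subseteq> V \<and> limitin W ys y sequentially)"

text \<open>Each orbit serves as its own index, so the indexing map is the identity.\<close>

definition orbit_diagram_rank_partition :: "'a topology \<Rightarrow> bool" where
  "orbit_diagram_rank_partition W \<longleftrightarrow>
     rank_partition W (orbit_diagram W) (orbit_less W) (\<lambda>U. U)"

end

theory Submission
  imports Defs "HOL-Library.Ramsey"
begin

text \<open>
  Both directions rest on Vaught's back-and-forth method (\<open>back_and_forth\<close>): a relation between compact
  open sets that can be refined to any prescribed compact open set, on either side and up to finite
  partitions, is induced by a homeomorphism. As the ring of compact open sets is countable, all of
  its members can be treated in turn.

  Given a rank partition, the first axiom says that for a separated label \<open>q\<close> the points with label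
  at least \<open>q\<close> form an open set (\<open>openin_above_separated\<close>). Hence a point with separated label \<open>q\<close> has
  arbitrarily small \<open>trim\<close> neighbourhoods, in which \<open>q\<close> is the least label and, unless \<open>q < q\<close>, occurs only
  once. The second axiom and a minimality argument show that trim sets cover every compact open set
  (\<open>trim_cover\<close>), and overlapping trim sets can be made disjoint. Two trim sets of the same type are
  homeomorphic by back and forth, because a partition of one into trim sets can be copied to the
  other. Whenever a trim set is cut in two, one side retains a point of least label and is trim of the
  same type; so trim sets are pseudo-indecomposable and the space is primitive.

  In a primitive space every point has a base of pseudo-indecomposable neighbourhoods. Order the
  isomorphism types of such sets by \<open>B \<le> A\<close> iff \<open>A\<close> embeds in \<open>B\<close>; this is antisymmetric
  (\<open>PI_embeds_antisym\<close>), and a strictly larger type is absorbed by a smaller one. Attach to \<open>x\<close> the set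
  \<open>types x\<close> of all types below the type of some neighbourhood of \<open>x\<close>, a directed set that is closed
  downwards. A pointed back-and-forth argument shows that \<open>x\<close> and \<open>y\<close> lie in the same orbit iff
  \<open>types x = types y\<close> (\<open>types_eq_imp_orbit\<close>), and the order of the orbit diagram is inclusion of these sets
  (\<open>orbit_le_iff\<close>), which makes it a PO system. By compactness every non-empty directed set of types
  is cofinal in \<open>types u\<close> for some \<open>u\<close> (\<open>directed_types_realised\<close>). Therefore an orbit is separated exactly if
  its set of types has a greatest element, and the axioms of a rank partition can be read off.
\<close>

section \<open>Compact open sets and their isomorphisms\<close>

locale omega_stone =
  fixes W :: "'a topology"
  assumes omega_stone: "omega_stone_space W"
begin

lemma Hausdorff: "Hausdorff_space W"
  and countable_Co: "countable (Co W)"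
  using omega_stone by (auto simp: omega_stone_space_def stone_space_def)

lemma Co_openin: "C \<in> Co W \<Longrightarrow> openin W C"
  and Co_compactin: "C \<in> Co W \<Longrightarrow> compactin W C"
  and Co_closedin: "C \<in> Co W \<Longrightarrow> closedin W C"
  and Co_subset_topspace: "C \<in> Co W \<Longrightarrow> C \<subseteq> topspace W"
  using compactin_imp_closedin[OF Hausdorff]
  by (auto simp: Co_def dest: openin_subset)

lemma Co_empty [simp]: "{} \<in> Co W"
  by (simp add: Co_def)

lemma Co_Un: "C \<in> Co W \<Longrightarrow> D \<in> Co W \<Longrightarrow> C \<union> D \<in> Co W"
  by (simp add: Co_def compactin_Un openin_Un)

lemma Co_Int: "C \<in> Co W \<Longrightarrow> D \<in> Co W \<Longrightarrow> C \<inter> D \<in> Co W"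
  using Co_closedin[of C] by (simp add: Co_def closed_Int_compactin openin_Int)

lemma Co_Diff: "C \<in> Co W \<Longrightarrow> D \<in> Co W \<Longrightarrow> C - D \<in> Co W"
proof -
  assume C: "C \<in> Co W" and D: "D \<in> Co W"
  have "openin W (C - D)"
    using C D by (simp add: openin_diff Co_openin Co_closedin)
  moreover have "compactin W (C - D)"
    using closed_compactin[of W C "C - D"] C D
    by (simp add: Co_compactin closedin_diff Co_closedin Co_openin)
  ultimately show ?thesis by (simp add: Co_def)
qed

lemma Co_Union: "finite F \<Longrightarrow> F \<subseteq> Co W \<Longrightarrow> \<Union>F \<in> Co W"
  by (induction rule: finite_induct) (auto simp: Co_Un)

lemma Co_base:
  assumes "openin W U" "x \<in> U"
  obtains C where "C \<in> Co W" "x \<in> C" "C \<subseteq> U"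
proof -
  obtain B where B: "\<forall>V\<in>B. openin W V \<and> compactin W V"
    "\<And>U x. openin W U \<and> x \<in> U \<Longrightarrow> \<exists>V\<in>B. x \<in> V \<and> V \<subseteq> U"
    using omega_stone unfolding omega_stone_space_def stone_space_def by blast
  obtain V where V: "V \<in> B" "x \<in> V" "V \<subseteq> U" using B(2)[of U x] assms by auto
  then have "V \<in> Co W" using B(1) by (simp add: Co_def)
  then show thesis using that V by simp
qed

lemma Co_nbhd:
  assumes "x \<in> topspace W"
  obtains C where "C \<in> Co W" "x \<in> C"
  by (rule Co_base[OF openin_topspace assms])

lemma Co_separate:
  assumes "x \<in> topspace W" "y \<in> topspace W" "x \<noteq> y"
  obtains C D where "C \<in> Co W" "D \<in> Co W" "x \<in> C" "y \<in> D" "C \<inter> D = {}"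
proof -
  obtain U V where UV: "openin W U" "openin W V" "x \<in> U" "y \<in> V" "disjnt U V"
    using Hausdorff assms unfolding Hausdorff_space_def by blast
  obtain C where C: "C \<in> Co W" "x \<in> C" "C \<subseteq> U"
    by (rule Co_base[OF UV(1,3)])
  obtain D where D: "D \<in> Co W" "y \<in> D" "D \<subseteq> V"
    by (rule Co_base[OF UV(2,4)])
  show thesis using that[of C D] C D UV(5) by (auto simp: disjnt_def)
qed

lemma Co_enum:
  obtains e :: "nat \<Rightarrow> 'a set" where "range e = Co W"
  using range_from_nat_into[OF _ countable_Co] Co_empty by blast

text \<open>In this form compactness turns a descending choice of pieces into a point; both the
  bijection built by back and forth and the points of prescribed type arise this way.\<close>

lemma Co_nest:
  fixes K :: "nat \<Rightarrow> 'a set"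
  assumes K: "\<And>n. K n \<in> Co W" "\<And>n. K n \<noteq> {}" "\<And>n. K (Suc n) \<subseteq> K n"
  shows "(\<Inter>n. K n) \<noteq> {}"
proof -
  have dec: "K n \<subseteq> K m" if "m \<le> n" for m n
    using that K(3) by (rule lift_Suc_antimono_le[rotated])
  have "K 0 \<inter> \<Inter>(range K) \<noteq> {}"
  proof -
    have "\<forall>F. finite F \<and> F \<subseteq> range K \<longrightarrow> K 0 \<inter> \<Inter>F \<noteq> {}"
    proof (intro allI impI)
      fix F assume F: "finite F \<and> F \<subseteq> range K"
      then obtain I where I: "finite I" "F = K ` I" using finite_subset_image by metis
      have "K (Max (insert 0 I)) \<subseteq> K 0 \<inter> \<Inter>F"
      proof -
        have "K (Max (insert 0 I)) \<subseteq> K i" if "i \<in> insert 0 I" for i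
          using that I(1) by (intro dec Max_ge) auto
        then show ?thesis using I(2) by blast
      qed
      then show "K 0 \<inter> \<Inter>F \<noteq> {}" using K(2) by blast
    qed
    moreover have "\<forall>C\<in>range K. closedin W C" using K(1) Co_closedin by blast
    ultimately show ?thesis using Co_compactin[OF K(1)[of 0]] unfolding compactin_fip by blast
  qed
  then show ?thesis by blast
qed

lemma Co_nbhd_seq:
  assumes x: "x \<in> topspace W"
  obtains N :: "nat \<Rightarrow> 'a set" where "\<And>n. N n \<in> Co W" "\<And>n. x \<in> N n" "\<And>n. N (Suc n) \<subseteq> N n"
    "\<And>U. openin W U \<Longrightarrow> x \<in> U \<Longrightarrow> \<exists>n. N n \<subseteq> U"
proof -
  obtain e :: "nat \<Rightarrow> 'a set" where e: "range e = Co W" using Co_enum .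
  obtain C where C: "C \<in> Co W" "x \<in> C" by (rule Co_nbhd[OF x])
  define N where "N = rec_nat C (\<lambda>n M. if x \<in> e n then M \<inter> e n else M)"
  have [simp]: "N 0 = C" "\<And>n. N (Suc n) = (if x \<in> e n then N n \<inter> e n else N n)"
    by (auto simp: N_def)
  have eC: "e n \<in> Co W" for n using e by auto
  have 1: "N n \<in> Co W \<and> x \<in> N n" for n
    by (induction n) (auto simp: C eC Co_Int)
  have "\<exists>n. N n \<subseteq> U" if U: "openin W U" "x \<in> U" for U
  proof -
    obtain D where D: "D \<in> Co W" "x \<in> D" "D \<subseteq> U" by (rule Co_base[OF U])
    then obtain n where "D = e n" using e by blast
    then have "N (Suc n) \<subseteq> U" using D by auto
    then show ?thesis by blast
  qed
  then show thesis using that[of N] 1 by auto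
qed

lemma limitin_nbhd_seq:
  assumes "x \<in> topspace W" "\<And>n. N (Suc n) \<subseteq> N n"
    "\<And>U. openin W U \<Longrightarrow> x \<in> U \<Longrightarrow> \<exists>n. N n \<subseteq> U" "\<And>n. xs n \<in> N n"
  shows "limitin W xs x sequentially"
  unfolding limitin_sequentially
proof (intro conjI allI impI)
  fix U assume "openin W U \<and> x \<in> U"
  then obtain n where n: "N n \<subseteq> U" using assms(3) by blast
  have "N m \<subseteq> N n" if "n \<le> m" for m
    using that assms(2) by (rule lift_Suc_antimono_le[rotated])
  then show "\<exists>n. \<forall>m\<ge>n. xs m \<in> U" using n assms(4) by blast
qed (use assms in auto)

text \<open>Homeomorphisms between compact open sets, expressed by their effect on compact open subsets.
  Since these subsets form a base the notion is the usual one, but restricting, composing and gluing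
  become statements about images of sets, and the link with isomorphisms of principal rings is
  immediate.\<close>

definition co_iso :: "'a set \<Rightarrow> 'a set \<Rightarrow> ('a \<Rightarrow> 'a) \<Rightarrow> bool" where
  "co_iso A B f \<longleftrightarrow> A \<in> Co W \<and> B \<in> Co W \<and> bij_betw f A B \<and>
     (\<forall>C. C \<subseteq> A \<longrightarrow> f ` C \<in> Co W \<longleftrightarrow> C \<in> Co W)"

definition cong :: "'a set \<Rightarrow> 'a set \<Rightarrow> bool" (infix \<open>\<asymp>\<close> 50) where
  "A \<asymp> B \<longleftrightarrow> (\<exists>f. co_iso A B f)"

lemma co_iso_id: "A \<in> Co W \<Longrightarrow> co_iso A A (\<lambda>x. x)"
  by (auto simp: co_iso_def bij_betw_def)

lemma co_iso_inv:
  assumes f: "co_iso A B f"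
  shows "co_iso B A (inv_into A f)"
proof -
  have b: "bij_betw f A B" using f by (simp add: co_iso_def)
  have "inv_into A f ` D \<in> Co W \<longleftrightarrow> D \<in> Co W" if D: "D \<subseteq> B" for D
  proof -
    have "inv_into A f ` D \<subseteq> A"
      using image_mono[OF D, of "inv_into A f"] bij_betw_imp_surj_on[OF bij_betw_inv_into[OF b]]
      by simp
    moreover have "f ` inv_into A f ` D = D"
      using image_inv_into_cancel[OF bij_betw_imp_surj_on[OF b] D] .
    moreover have "f ` C \<in> Co W \<longleftrightarrow> C \<in> Co W" if "C \<subseteq> A" for C
      using f that by (simp add: co_iso_def)
    ultimately show ?thesis by metis
  qed
  then show ?thesis using f bij_betw_inv_into[OF b] by (simp add: co_iso_def)
qed

lemma co_iso_comp:
  assumes f: "co_iso A B f" and g: "co_iso B C g"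
  shows "co_iso A C (g \<circ> f)"
proof -
  have "(g \<circ> f) ` D \<in> Co W \<longleftrightarrow> D \<in> Co W" if D: "D \<subseteq> A" for D
  proof -
    have "f ` D \<subseteq> B" using f D by (auto simp: co_iso_def bij_betw_def)
    then have "g ` f ` D \<in> Co W \<longleftrightarrow> f ` D \<in> Co W" using g by (simp add: co_iso_def)
    also have "\<dots> \<longleftrightarrow> D \<in> Co W" using f D by (simp add: co_iso_def)
    finally show ?thesis by (simp add: image_comp)
  qed
  then show ?thesis using f g by (auto simp: co_iso_def intro: bij_betw_trans)
qed

lemma co_iso_restrict:
  assumes f: "co_iso A B f" and C: "C \<in> Co W" "C \<subseteq> A"
  shows "co_iso C (f ` C) f"
  using assms by (auto simp: co_iso_def bij_betw_def inj_on_subset)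

lemma co_iso_glue:
  assumes f: "co_iso A B f" and g: "co_iso A' B' g" and d: "A \<inter> A' = {}" "B \<inter> B' = {}"
  shows "co_iso (A \<union> A') (B \<union> B') (\<lambda>x. if x \<in> A then f x else g x)"
proof -
  let ?h = "\<lambda>x. if x \<in> A then f x else g x"
  have im: "?h ` D = f ` (D \<inter> A) \<union> g ` (D \<inter> A')" if "D \<subseteq> A \<union> A'" for D
  proof -
    have "D = (D \<inter> A) \<union> (D \<inter> A')" using that by blast
    then have "?h ` D = ?h ` (D \<inter> A) \<union> ?h ` (D \<inter> A')" using image_Un by blast
    moreover have "?h ` (D \<inter> A) = f ` (D \<inter> A)" by (rule image_cong) auto
    moreover have "?h ` (D \<inter> A') = g ` (D \<inter> A')" using d(1) by (intro image_cong) auto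
    ultimately show ?thesis by simp
  qed
  have bf: "bij_betw f A B" and bg: "bij_betw g A' B'" using f g by (auto simp: co_iso_def)
  have Co: "A \<in> Co W" "A' \<in> Co W" "B \<in> Co W" "B' \<in> Co W" using f g by (auto simp: co_iso_def)
  have "bij_betw ?h A B" using bf by (subst bij_betw_cong[where g = f]) auto
  moreover have "bij_betw ?h A' B'"
    using bg d(1) by (subst bij_betw_cong[where g = g]) auto
  ultimately have bij: "bij_betw ?h (A \<union> A') (B \<union> B')"
    using d(2) by (rule bij_betw_combine)
  have "?h ` D \<in> Co W \<longleftrightarrow> D \<in> Co W" if D: "D \<subseteq> A \<union> A'" for D
  proof -
    have fD: "f ` (D \<inter> A) \<subseteq> B" and gD: "g ` (D \<inter> A') \<subseteq> B'"
      using bf bg by (auto simp: bij_betw_def)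
    have 1: "f ` (D \<inter> A) \<in> Co W \<longleftrightarrow> D \<inter> A \<in> Co W" "g ` (D \<inter> A') \<in> Co W \<longleftrightarrow> D \<inter> A' \<in> Co W"
      using f g by (auto simp: co_iso_def)
    have "?h ` D \<inter> B = f ` (D \<inter> A)" "?h ` D \<inter> B' = g ` (D \<inter> A')"
      using im[OF D] fD gD d(2) by auto
    then have 2: "?h ` D \<in> Co W \<Longrightarrow> f ` (D \<inter> A) \<in> Co W \<and> g ` (D \<inter> A') \<in> Co W"
      using Co_Int[of "?h ` D" B] Co_Int[of "?h ` D" B'] Co by simp
    have "(D \<inter> A) \<union> (D \<inter> A') = D" using D by auto
    then have 3: "D \<in> Co W \<longleftrightarrow> D \<inter> A \<in> Co W \<and> D \<inter> A' \<in> Co W"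
      using Co Co_Int Co_Un[of "D \<inter> A" "D \<inter> A'"] by auto
    have 4: "f ` (D \<inter> A) \<in> Co W \<Longrightarrow> g ` (D \<inter> A') \<in> Co W \<Longrightarrow> ?h ` D \<in> Co W"
      unfolding im[OF D] by (rule Co_Un)
    show ?thesis using 1 2 3 4 by blast
  qed
  then show ?thesis using bij Co by (simp add: co_iso_def Co_Un)
qed

lemma cong_Co: "A \<asymp> B \<Longrightarrow> A \<in> Co W \<and> B \<in> Co W"
  by (auto simp: cong_def co_iso_def)

lemma cong_refl [simp]: "A \<asymp> A \<longleftrightarrow> A \<in> Co W"
  using co_iso_id cong_Co by (auto simp: cong_def)

lemma cong_sym: "A \<asymp> B \<Longrightarrow> B \<asymp> A"
  using co_iso_inv by (auto simp: cong_def)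

lemma cong_trans [trans]: "A \<asymp> B \<Longrightarrow> B \<asymp> C \<Longrightarrow> A \<asymp> C"
  using co_iso_comp unfolding cong_def by blast

lemma cong_empty: "A \<asymp> B \<Longrightarrow> A = {} \<longleftrightarrow> B = {}"
  by (auto simp: cong_def co_iso_def bij_betw_def)

lemma cong_Un:
  "A \<asymp> B \<Longrightarrow> A' \<asymp> B' \<Longrightarrow> A \<inter> A' = {} \<Longrightarrow> B \<inter> B' = {} \<Longrightarrow> A \<union> A' \<asymp> B \<union> B'"
  using co_iso_glue unfolding cong_def by blast

lemma cong_split:
  assumes "A \<asymp> B" "C \<in> Co W" "C \<subseteq> A"
  obtains D where "D \<in> Co W" "D \<subseteq> B" "C \<asymp> D" "A - C \<asymp> B - D"
proof -
  obtain f where f: "co_iso A B f" using assms by (auto simp: cong_def)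
  have b: "bij_betw f A B" using f by (simp add: co_iso_def)
  have AC: "A - C \<in> Co W" using assms cong_Co Co_Diff by blast
  have "f ` (A - C) = B - f ` C"
    using b assms(3) by (auto simp: bij_betw_def inj_on_def)
  then have "A - C \<asymp> B - f ` C"
    using co_iso_restrict[OF f AC] by (auto simp: cong_def)
  moreover have "C \<asymp> f ` C" using co_iso_restrict[OF f assms(2,3)] by (auto simp: cong_def)
  moreover have "f ` C \<subseteq> B" using b assms(3) by (auto simp: bij_betw_def)
  ultimately show thesis using that cong_Co by blast
qed

section \<open>Back and forth between compact open sets\<close>

text \<open>A matching is one stage of a back-and-forth construction: simultaneous finite partitions of
  \<open>A\<close> and of \<open>B\<close>, corresponding pieces being related by \<open>R\<close>.\<close>

definition matching :: "('a set \<Rightarrow> 'a set \<Rightarrow> bool) \<Rightarrow> 'a set \<Rightarrow> 'a set \<Rightarrow> ('a set \<times> 'a set) set \<Rightarrow> bool" where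
  "matching R A B \<pi> \<longleftrightarrow> finite \<pi> \<and> (\<forall>p\<in>\<pi>. R (fst p) (snd p)) \<and>
     (\<forall>p\<in>\<pi>. \<forall>q\<in>\<pi>. p \<noteq> q \<longrightarrow> fst p \<inter> fst q = {} \<and> snd p \<inter> snd q = {}) \<and>
     \<Union>(fst ` \<pi>) = A \<and> \<Union>(snd ` \<pi>) = B"

definition decides :: "'a set \<Rightarrow> 'a set \<Rightarrow> bool" where
  "decides C U \<longleftrightarrow> U \<subseteq> C \<or> U \<inter> C = {}"

text \<open>The extension property is asked for one set \<open>C\<close> at a time, and only up to a finite
  partition: the two halves \<open>A \<inter> C\<close> and \<open>A - C\<close> may be cut further before they are matched. This
  freedom is what makes the property easy to verify for relations such as ``trim of the same type'',
  where the halves themselves need not be comparable with anything in \<open>B\<close>.\<close>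

definition forth :: "('a set \<Rightarrow> 'a set \<Rightarrow> bool) \<Rightarrow> bool" where
  "forth R \<longleftrightarrow> (\<forall>A B C. R A B \<longrightarrow> C \<in> Co W \<longrightarrow>
     (\<exists>\<pi>. matching R A B \<pi> \<and> (\<forall>p\<in>\<pi>. decides C (fst p))))"

definition finer :: "('a set \<times> 'a set) set \<Rightarrow> ('a set \<times> 'a set) set \<Rightarrow> bool" where
  "finer \<pi>' \<pi> \<longleftrightarrow> (\<forall>p\<in>\<pi>'. \<exists>q\<in>\<pi>. fst p \<subseteq> fst q \<and> snd p \<subseteq> snd q)"

lemma matching_finite: "matching R A B \<pi> \<Longrightarrow> finite \<pi>"
  and matching_rel: "matching R A B \<pi> \<Longrightarrow> p \<in> \<pi> \<Longrightarrow> R (fst p) (snd p)"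
  and matching_fst: "matching R A B \<pi> \<Longrightarrow> p \<in> \<pi> \<Longrightarrow> fst p \<subseteq> A"
  and matching_snd: "matching R A B \<pi> \<Longrightarrow> p \<in> \<pi> \<Longrightarrow> snd p \<subseteq> B"
  by (auto simp: matching_def)

lemma matching_swap:
  assumes "matching R A B \<pi>"
  shows "matching R\<inverse>\<inverse> B A (prod.swap ` \<pi>)"
proof -
  have "fst p \<inter> fst q = {} \<and> snd p \<inter> snd q = {}"
    if p: "p \<in> prod.swap ` \<pi>" "q \<in> prod.swap ` \<pi>" "p \<noteq> q" for p q
  proof -
    have "prod.swap p \<in> \<pi>" "prod.swap q \<in> \<pi>" "prod.swap p \<noteq> prod.swap q" using p by auto
    then have "fst (prod.swap p) \<inter> fst (prod.swap q) = {} \<and> snd (prod.swap p) \<inter> snd (prod.swap q) = {}"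
      using assms unfolding matching_def by blast
    then show ?thesis by simp
  qed
  then show ?thesis using assms by (simp add: matching_def image_image)
qed

lemma matching_Un:
  assumes 1: "matching R A B \<pi>" and 2: "matching R A' B' \<pi>'" and d: "A \<inter> A' = {}" "B \<inter> B' = {}"
  shows "matching R (A \<union> A') (B \<union> B') (\<pi> \<union> \<pi>')"
proof -
  have *: "fst p \<inter> fst q = {} \<and> snd p \<inter> snd q = {}" if p: "p \<in> \<pi>" "q \<in> \<pi>'" for p q
  proof -
    have "fst p \<subseteq> A" "snd p \<subseteq> B" using 1 p by (auto simp: matching_def)
    moreover have "fst q \<subseteq> A'" "snd q \<subseteq> B'" using 2 p by (auto simp: matching_def)
    ultimately show ?thesis using d by blast
  qed
  have "fst p \<inter> fst q = {} \<and> snd p \<inter> snd q = {}"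
    if pq: "p \<in> \<pi> \<union> \<pi>'" "q \<in> \<pi> \<union> \<pi>'" "p \<noteq> q" for p q
  proof -
    consider "p \<in> \<pi>" "q \<in> \<pi>" | "p \<in> \<pi>'" "q \<in> \<pi>'" | "p \<in> \<pi>" "q \<in> \<pi>'" | "q \<in> \<pi>" "p \<in> \<pi>'"
      using pq by blast
    then show ?thesis
    proof cases
      case 1 then show ?thesis using assms(1) pq(3) by (simp add: matching_def)
    next
      case 2 then show ?thesis using assms(2) pq(3) by (simp add: matching_def)
    next
      case 3 then show ?thesis using * by blast
    next
      case 4 then show ?thesis using *[of q p] by blast
    qed
  qed
  moreover have "\<Union>(fst ` (\<pi> \<union> \<pi>')) = A \<union> A'" "\<Union>(snd ` (\<pi> \<union> \<pi>')) = B \<union> B'"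
    using 1 2 by (auto simp: matching_def)
  moreover have "\<forall>p\<in>\<pi> \<union> \<pi>'. R (fst p) (snd p)" "finite (\<pi> \<union> \<pi>')"
    using 1 2 by (auto simp: matching_def)
  ultimately show ?thesis unfolding matching_def by blast
qed

lemma matching_singleton: "R A B \<Longrightarrow> matching R A B {(A, B)}"
  by (simp add: matching_def)

lemma matching_refine:
  assumes m: "matching R A B \<pi>" and fo: "forth R" and C: "C \<in> Co W"
  obtains \<pi>' where "matching R A B \<pi>'" "finer \<pi>' \<pi>" "\<forall>p\<in>\<pi>'. decides C (fst p)"
proof -
  have "\<forall>p\<in>\<pi>. \<exists>\<rho>. matching R (fst p) (snd p) \<rho> \<and> (\<forall>p\<in>\<rho>. decides C (fst p))"
  proof
    fix p assume "p \<in> \<pi>"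
    then have "R (fst p) (snd p)" using m by (simp add: matching_def)
    then show "\<exists>\<rho>. matching R (fst p) (snd p) \<rho> \<and> (\<forall>p\<in>\<rho>. decides C (fst p))"
      using fo C unfolding forth_def by blast
  qed
  then obtain \<rho> where \<rho>: "\<And>p. p \<in> \<pi> \<Longrightarrow> matching R (fst p) (snd p) (\<rho> p)"
    "\<And>p q. p \<in> \<pi> \<Longrightarrow> q \<in> \<rho> p \<Longrightarrow> decides C (fst q)" by metis
  have sub: "fst q \<subseteq> fst p \<and> snd q \<subseteq> snd p" if "p \<in> \<pi>" "q \<in> \<rho> p" for p q
    using \<rho>(1)[OF that(1)] that(2) by (auto simp: matching_def)
  let ?\<pi> = "\<Union>(\<rho> ` \<pi>)"
  have fin: "finite ?\<pi>" using m \<rho>(1) by (auto simp: matching_def)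
  have R: "R (fst q) (snd q)" if "q \<in> ?\<pi>" for q
    using \<rho>(1) that by (auto simp: matching_def)
  have disj: "fst q \<inter> fst q' = {} \<and> snd q \<inter> snd q' = {}"
    if q: "q \<in> ?\<pi>" "q' \<in> ?\<pi>" "q \<noteq> q'" for q q'
  proof -
    obtain p p' where p: "p \<in> \<pi>" "q \<in> \<rho> p" "p' \<in> \<pi>" "q' \<in> \<rho> p'" using q by blast
    show ?thesis
    proof (cases "p = p'")
      case True then show ?thesis using \<rho>(1)[OF p(1)] p q(3) by (simp add: matching_def)
    next
      case False
      then have "fst p \<inter> fst p' = {} \<and> snd p \<inter> snd p' = {}"
        using m p by (simp add: matching_def)
      then show ?thesis using sub p by blast
    qed
  qed
  have un: "\<Union>(fst ` ?\<pi>) = A" "\<Union>(snd ` ?\<pi>) = B"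
  proof -
    have "\<Union>(fst ` ?\<pi>) = (\<Union>p\<in>\<pi>. \<Union>(fst ` \<rho> p))" by blast
    also have "\<dots> = (\<Union>p\<in>\<pi>. fst p)"
      by (rule SUP_cong) (use \<rho>(1) in \<open>auto simp: matching_def\<close>)
    finally show "\<Union>(fst ` ?\<pi>) = A" using m by (simp add: matching_def)
    have "\<Union>(snd ` ?\<pi>) = (\<Union>p\<in>\<pi>. \<Union>(snd ` \<rho> p))" by blast
    also have "\<dots> = (\<Union>p\<in>\<pi>. snd p)"
      by (rule SUP_cong) (use \<rho>(1) in \<open>auto simp: matching_def\<close>)
    finally show "\<Union>(snd ` ?\<pi>) = B" using m by (simp add: matching_def)
  qed
  have "matching R A B ?\<pi>"
    unfolding matching_def by (intro conjI ballI impI fin un R disj[THEN conjunct1] disj[THEN conjunct2])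
  moreover have "finer ?\<pi> \<pi>"
    unfolding finer_def using sub by blast
  moreover have "\<forall>p\<in>?\<pi>. decides C (fst p)" using \<rho>(2) by blast
  ultimately show thesis by (rule that)
qed

lemma finer_trans: "finer \<pi>'' \<pi>' \<Longrightarrow> finer \<pi>' \<pi> \<Longrightarrow> finer \<pi>'' \<pi>"
  unfolding finer_def by (meson subset_trans)

lemma finer_swap: "finer \<pi>' \<pi> \<Longrightarrow> finer (prod.swap ` \<pi>') (prod.swap ` \<pi>)"
  unfolding finer_def by force

lemma matching_refine_both:
  assumes m: "matching R A B \<pi>" and fo: "forth R" "forth R\<inverse>\<inverse>" and C: "C \<in> Co W"
  obtains \<pi>' where "matching R A B \<pi>'" "finer \<pi>' \<pi>"
    "\<forall>p\<in>\<pi>'. decides C (fst p) \<and> decides C (snd p)"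
proof -
  obtain \<pi>1 where 1: "matching R A B \<pi>1" "finer \<pi>1 \<pi>" "\<forall>p\<in>\<pi>1. decides C (fst p)"
    by (rule matching_refine[OF m fo(1) C])
  obtain \<pi>2 where 2: "matching R\<inverse>\<inverse> B A \<pi>2" "finer \<pi>2 (prod.swap ` \<pi>1)"
    "\<forall>p\<in>\<pi>2. decides C (fst p)"
    by (rule matching_refine[OF matching_swap[OF 1(1)] fo(2) C])
  have m2: "matching R A B (prod.swap ` \<pi>2)"
    using matching_swap[OF 2(1)] by simp
  have r2: "finer (prod.swap ` \<pi>2) \<pi>1"
    using finer_swap[OF 2(2)] by (simp add: image_image)
  have "decides C (fst p) \<and> decides C (snd p)" if p: "p \<in> prod.swap ` \<pi>2" for p
  proof -
    obtain q where q: "q \<in> \<pi>1" "fst p \<subseteq> fst q" using r2 p unfolding finer_def by blast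
    then have "decides C (fst p)" using 1(3) unfolding decides_def by blast
    moreover have "decides C (snd p)" using 2(3) p by auto
    ultimately show ?thesis ..
  qed
  then show thesis using that[OF m2 finer_trans[OF r2 1(2)]] by blast
qed

text \<open>A point \<open>a\<close> runs through a descending sequence of pieces of \<open>A\<close>, and the partner pieces in
  \<open>B\<close> shrink to exactly one point: compactness gives one, and the pieces eventually decide a compact
  open set that separates two candidates.\<close>

lemma matching_thread:
  assumes R: "\<And>U V. R U V \<Longrightarrow> V \<in> Co W \<and> (U = {} \<longleftrightarrow> V = {})"
    and m: "\<And>n. matching R A B (\<sigma> n)" and r: "\<And>n. finer (\<sigma> (Suc n)) (\<sigma> n)"
    and d: "\<And>C. C \<in> Co W \<Longrightarrow> \<exists>n. \<forall>p\<in>\<sigma> n. decides C (snd p)"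
    and a: "a \<in> A"
  shows "\<exists>!b. \<forall>n. \<exists>p\<in>\<sigma> n. a \<in> fst p \<and> b \<in> snd p"
proof -
  have uniq: "p = q" if "p \<in> \<sigma> n" "q \<in> \<sigma> n" "a \<in> fst p" "a \<in> fst q" for p q n
    using m[of n] that unfolding matching_def by blast
  have "\<forall>n. \<exists>p. p \<in> \<sigma> n \<and> a \<in> fst p"
  proof
    fix n have "a \<in> \<Union>(fst ` \<sigma> n)" using a m[of n] by (simp add: matching_def)
    then show "\<exists>p. p \<in> \<sigma> n \<and> a \<in> fst p" by blast
  qed
  then obtain p where p: "\<And>n. p n \<in> \<sigma> n" "\<And>n. a \<in> fst (p n)" by metis
  have Rp: "R (fst (p n)) (snd (p n))" for n using p(1) m[of n] by (simp add: matching_def)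
  have "(\<Inter>n. snd (p n)) \<noteq> {}"
  proof (rule Co_nest)
    fix n
    show "snd (p n) \<in> Co W" using R[OF Rp] by simp
    show "snd (p n) \<noteq> {}" using R[OF Rp] p(2)[of n] by auto
    obtain q where q: "q \<in> \<sigma> n" "fst (p (Suc n)) \<subseteq> fst q" "snd (p (Suc n)) \<subseteq> snd q"
      using r[of n] p(1)[of "Suc n"] unfolding finer_def by blast
    then have "q = p n" using uniq[of q n "p n"] p by blast
    then show "snd (p (Suc n)) \<subseteq> snd (p n)" using q by simp
  qed
  then obtain b where b: "\<And>n. b \<in> snd (p n)" by blast
  show ?thesis
  proof (rule ex1I[of _ b])
    show "\<forall>n. \<exists>p\<in>\<sigma> n. a \<in> fst p \<and> b \<in> snd p" using p b by blast
    fix c assume c: "\<forall>n. \<exists>p\<in>\<sigma> n. a \<in> fst p \<and> c \<in> snd p"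
    have cp: "c \<in> snd (p n)" for n
    proof -
      obtain q where "q \<in> \<sigma> n" "a \<in> fst q" "c \<in> snd q" using c by blast
      then show ?thesis using uniq[of q n "p n"] p by simp
    qed
    have "snd (p 0) \<subseteq> topspace W" using R[OF Rp] Co_subset_topspace by blast
    then have t: "b \<in> topspace W" "c \<in> topspace W" using b cp by auto
    show "c = b"
    proof (rule ccontr)
      assume "c \<noteq> b"
      then obtain C D where CD: "C \<in> Co W" "D \<in> Co W" "c \<in> C" "b \<in> D" "C \<inter> D = {}"
        by (rule Co_separate[OF t(2,1)])
      obtain n where "\<forall>p\<in>\<sigma> n. decides C (snd p)" using d[OF CD(1)] ..
      then have "decides C (snd (p n))" using p(1)[of n] by simp
      then show False using CD(3-5) b[of n] cp[of n] by (auto simp: decides_def)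
    qed
  qed
qed

text \<open>Vaught's argument. All compact open sets are enumerated and the matchings are refined so
  that the \<open>n\<close>-th set is decided on both sides at stage \<open>n + 1\<close>; the limit of the matchings is the
  graph of a bijection, which preserves compact open sets because each of them is a finite union of
  pieces. The second conclusion records that every point and its image are surrounded by related
  pieces, so a relation that keeps track of a marked point controls the image of that point.\<close>

theorem back_and_forth:
  assumes R: "\<And>U V. R U V \<Longrightarrow> U \<in> Co W \<and> V \<in> Co W \<and> (U = {} \<longleftrightarrow> V = {})"
    and fo: "forth R" "forth R\<inverse>\<inverse>" and AB: "R A B"
  obtains f where "co_iso A B f"
    "\<And>a N. a \<in> A \<Longrightarrow> N \<in> Co W \<Longrightarrow> f a \<in> N \<Longrightarrow> \<exists>U V. R U V \<and> a \<in> U \<and> V \<subseteq> N"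
proof -
  obtain e :: "nat \<Rightarrow> 'a set" where e: "range e = Co W" by (rule Co_enum)
  have eC: "e n \<in> Co W" for n using e by blast
  have "\<exists>\<sigma>. \<forall>n. matching R A B (\<sigma> n) \<and> (finer (\<sigma> (Suc n)) (\<sigma> n) \<and>
      (\<forall>p\<in>\<sigma> (Suc n). decides (e n) (fst p) \<and> decides (e n) (snd p)))"
  proof (rule dependent_nat_choice)
    show "\<exists>\<pi>. matching R A B \<pi>" using matching_singleton AB by blast
  next
    fix \<pi> n assume "matching R A B \<pi>"
    then show "\<exists>\<pi>'. matching R A B \<pi>' \<and> (finer \<pi>' \<pi> \<and>
        (\<forall>p\<in>\<pi>'. decides (e n) (fst p) \<and> decides (e n) (snd p)))"
      by (rule matching_refine_both[OF _ fo eC[of n]]) blast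
  qed
  then obtain \<sigma> where \<sigma>: "\<And>n. matching R A B (\<sigma> n)" "\<And>n. finer (\<sigma> (Suc n)) (\<sigma> n)"
    and dec: "\<And>n p. p \<in> \<sigma> (Suc n) \<Longrightarrow> decides (e n) (fst p) \<and> decides (e n) (snd p)"
    by blast
  define G where "G a b \<longleftrightarrow> (\<forall>n. \<exists>p\<in>\<sigma> n. a \<in> fst p \<and> b \<in> snd p)" for a b
  have ex_dec: "\<exists>n. \<forall>p\<in>\<sigma> n. decides C (fst p) \<and> decides C (snd p)" if C: "C \<in> Co W" for C
  proof -
    obtain n where n: "C = e n" using C unfolding e[symmetric] by (rule imageE)
    show ?thesis unfolding n by (rule exI[of _ "Suc n"]) (simp add: dec)
  qed
  have Ga: "\<exists>!b. G a b" if "a \<in> A" for a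
    unfolding G_def
  proof (rule matching_thread[where R = R and \<sigma> = \<sigma>, OF _ \<sigma>])
    show "V \<in> Co W \<and> (U = {} \<longleftrightarrow> V = {})" if "R U V" for U V using R that by blast
    show "\<exists>n. \<forall>p\<in>\<sigma> n. decides C (snd p)" if "C \<in> Co W" for C using ex_dec[OF that] by blast
  qed (rule that)
  have Gb: "\<exists>!a. G a b" if "b \<in> B" for b
  proof -
    have "\<exists>!a. \<forall>n. \<exists>p\<in>prod.swap ` \<sigma> n. b \<in> fst p \<and> a \<in> snd p"
    proof (rule matching_thread)
      show "V \<in> Co W \<and> (U = {} \<longleftrightarrow> V = {})" if "R\<inverse>\<inverse> U V" for U V using R[of V U] that by simp
      show "matching R\<inverse>\<inverse> B A (prod.swap ` \<sigma> n)" for n using \<sigma>(1) by (rule matching_swap)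
      show "finer (prod.swap ` \<sigma> (Suc n)) (prod.swap ` \<sigma> n)" for n
        using \<sigma>(2) by (rule finer_swap)
      show "\<exists>n. \<forall>p\<in>prod.swap ` \<sigma> n. decides C (snd p)" if "C \<in> Co W" for C
        using ex_dec[OF that] by auto
    qed (rule that)
    then show ?thesis unfolding G_def by (simp add: conj_commute)
  qed
  define f where "f a = (THE b. G a b)" for a
  have Gf: "G a (f a)" if "a \<in> A" for a unfolding f_def using theI'[OF Ga[OF that]] .
  have GAB: "a \<in> A \<and> b \<in> B" if "G a b" for a b
  proof -
    obtain p where "p \<in> \<sigma> 0" "a \<in> fst p" "b \<in> snd p" using \<open>G a b\<close> unfolding G_def by blast
    then show ?thesis using matching_fst[OF \<sigma>(1)] matching_snd[OF \<sigma>(1)] by blast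
  qed
  have piece: "p = q" if "p \<in> \<sigma> n" "q \<in> \<sigma> n" "a \<in> fst p \<inter> fst q \<or> b \<in> snd p \<inter> snd q" for p q n a b
    using \<sigma>(1)[of n] that unfolding matching_def by blast
  have inj: "inj_on f A"
  proof (rule inj_onI)
    fix a a' assume "a \<in> A" "a' \<in> A" "f a = f a'"
    then have "G a (f a)" "G a' (f a)" using Gf by metis+
    moreover have "f a \<in> B" using Gf GAB \<open>a \<in> A\<close> by blast
    ultimately show "a = a'" using Gb by blast
  qed
  have Gfa: "f a = b" if "G a b" for a b
    using Ga Gf GAB that by blast
  have bij: "bij_betw f A B"
    unfolding bij_betw_def
  proof
    show "f ` A = B" using Gf GAB Gb Gfa by blast
  qed (rule inj)
  have piece_f: "a \<in> fst p \<longleftrightarrow> f a \<in> snd p" if ap: "a \<in> A" "p \<in> \<sigma> n" for a p n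
  proof -
    obtain q where "q \<in> \<sigma> n" "a \<in> fst q" "f a \<in> snd q"
      using Gf[OF ap(1)] unfolding G_def by blast
    then show ?thesis using piece[of p n q a "f a"] ap(2) by blast
  qed
  have RC: "fst p \<in> Co W \<and> snd p \<in> Co W" if "p \<in> \<sigma> n" for p n
    using R[OF matching_rel[OF \<sigma>(1) that]] by simp
  have fin: "finite (\<sigma> n)" for n using \<sigma>(1) by (rule matching_finite)
  have covA: "\<exists>p\<in>\<sigma> n. a \<in> fst p" if "a \<in> A" for a n
    using Gf[OF that] unfolding G_def by blast
  have img: "f ` C \<in> Co W \<longleftrightarrow> C \<in> Co W" if C: "C \<subseteq> A" for C
  proof
    assume "C \<in> Co W"
    then obtain n where n: "C = e n" using e by blast
    have "f ` C = \<Union>(snd ` {p \<in> \<sigma> (Suc n). fst p \<subseteq> C})"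
    proof (intro equalityI subsetI)
      fix b assume "b \<in> f ` C"
      then obtain a where a: "a \<in> C" "b = f a" by blast
      obtain p where p: "p \<in> \<sigma> (Suc n)" "a \<in> fst p" using covA C a by blast
      then have "fst p \<subseteq> C" using dec[OF p(1)] a n unfolding decides_def by blast
      moreover have "b \<in> snd p" using piece_f p a C by blast
      ultimately show "b \<in> \<Union>(snd ` {p \<in> \<sigma> (Suc n). fst p \<subseteq> C})" using p by blast
    next
      fix b assume "b \<in> \<Union>(snd ` {p \<in> \<sigma> (Suc n). fst p \<subseteq> C})"
      then obtain p where p: "p \<in> \<sigma> (Suc n)" "fst p \<subseteq> C" "b \<in> snd p" by blast
      have "b \<in> B" using matching_snd[OF \<sigma>(1) p(1)] p(3) by blast
      then obtain a where a: "a \<in> A" "b = f a" using bij unfolding bij_betw_def by blast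
      then have "a \<in> fst p" using piece_f p by blast
      then show "b \<in> f ` C" using p a by blast
    qed
    also have "\<dots> \<in> Co W" using RC fin by (intro Co_Union) auto
    finally show "f ` C \<in> Co W" .
  next
    assume "f ` C \<in> Co W"
    then obtain n where n: "f ` C = e n" using e by (metis imageE)
    have "C = \<Union>(fst ` {p \<in> \<sigma> (Suc n). snd p \<subseteq> f ` C})"
    proof (intro equalityI subsetI)
      fix a assume a: "a \<in> C"
      obtain p where p: "p \<in> \<sigma> (Suc n)" "a \<in> fst p" using covA C a by blast
      then have "f a \<in> snd p" using piece_f a C by blast
      moreover have "f a \<in> e n" using a n by blast
      ultimately have "snd p \<subseteq> f ` C" using dec[OF p(1)] n unfolding decides_def by blast
      then show "a \<in> \<Union>(fst ` {p \<in> \<sigma> (Suc n). snd p \<subseteq> f ` C})" using p by blast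
    next
      fix a assume "a \<in> \<Union>(fst ` {p \<in> \<sigma> (Suc n). snd p \<subseteq> f ` C})"
      then obtain p where p: "p \<in> \<sigma> (Suc n)" "snd p \<subseteq> f ` C" "a \<in> fst p" by blast
      have a: "a \<in> A" using matching_fst[OF \<sigma>(1) p(1)] p(3) by blast
      then have "f a \<in> f ` C" using piece_f p by blast
      then show "a \<in> C" using inj_on_image_mem_iff[OF inj a C] by simp
    qed
    also have "\<dots> \<in> Co W" using RC fin by (intro Co_Union) auto
    finally show "C \<in> Co W" .
  qed
  have "co_iso A B f" using bij img R[OF AB] unfolding co_iso_def by blast
  moreover have "\<exists>U V. R U V \<and> a \<in> U \<and> V \<subseteq> N" if a: "a \<in> A" and N: "N \<in> Co W" "f a \<in> N" for a N
  proof -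
    obtain n where n: "N = e n" using N e by blast
    obtain p where p: "p \<in> \<sigma> (Suc n)" "a \<in> fst p" using covA a by blast
    then have "f a \<in> snd p" using piece_f a by blast
    then have "snd p \<subseteq> N" using dec[OF p(1)] n N unfolding decides_def by blast
    moreover have "R (fst p) (snd p)" by (rule matching_rel[OF \<sigma>(1) p(1)])
    ultimately show ?thesis using p by blast
  qed
  ultimately show thesis by (rule that)
qed

section \<open>Principal rings and orbits\<close>

lemma cong_imp_ring_iso:
  assumes "A \<asymp> B"
  shows "principal_ring W A \<simeq> principal_ring W B"
proof -
  obtain f where f: "co_iso A B f" using assms unfolding cong_def ..
  have bij: "bij_betw f A B" and inj: "inj_on f A" and im: "f ` A = B"
    using f by (auto simp: co_iso_def bij_betw_def)
  have Co: "f ` C \<in> Co W \<longleftrightarrow> C \<in> Co W" if "C \<subseteq> A" for C using f that by (simp add: co_iso_def)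
  have "bij_betw ((`) f) {C \<in> Co W. C \<subseteq> A} {C \<in> Co W. C \<subseteq> B}"
    unfolding bij_betw_def
  proof (intro conjI subset_antisym subsetI)
    show "inj_on ((`) f) {C \<in> Co W. C \<subseteq> A}"
      using inj_on_image_eq_iff[OF inj] by (auto simp: inj_on_def)
    fix D
    show "D \<in> {C \<in> Co W. C \<subseteq> B}" if "D \<in> (`) f ` {C \<in> Co W. C \<subseteq> A}"
      using that Co im by auto
    show "D \<in> (`) f ` {C \<in> Co W. C \<subseteq> A}" if D: "D \<in> {C \<in> Co W. C \<subseteq> B}"
    proof -
      have "D \<subseteq> f ` A" using D im by simp
      then obtain C where C: "C \<subseteq> A" "D = f ` C" by (rule subset_imageE)
      then show ?thesis using Co[OF C(1)] D by blast
    qed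
  qed
  moreover have "f ` (C \<inter> D) = f ` C \<inter> f ` D" if "C \<subseteq> A" "D \<subseteq> A" for C D
    using inj_on_image_Int[OF inj that] .
  moreover have "f ` sym_diff C D = sym_diff (f ` C) (f ` D)" if "C \<subseteq> A" "D \<subseteq> A" for C D
    using that inj_on_image_set_diff[OF inj, of C D] inj_on_image_set_diff[OF inj, of D C]
    by (auto simp: image_Un)
  ultimately have "(`) f \<in> ring_iso (principal_ring W A) (principal_ring W B)"
    using im by (auto simp: ring_iso_def ring_hom_def principal_ring_def bij_betw_def)
  then show ?thesis unfolding is_ring_iso_def by blast
qed

text \<open>Stone duality for principal rings, obtained from back and forth applied to the graph of the
  ring isomorphism.\<close>

lemma ring_iso_imp_cong:
  assumes A: "A \<in> Co W" and B: "B \<in> Co W" and iso: "principal_ring W A \<simeq> principal_ring W B"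
  shows "A \<asymp> B"
proof -
  obtain \<phi> where \<phi>: "\<phi> \<in> ring_iso (principal_ring W A) (principal_ring W B)"
    using iso unfolding is_ring_iso_def by blast
  let ?S = "\<lambda>A. {C \<in> Co W. C \<subseteq> A}"
  have bij: "bij_betw \<phi> (?S A) (?S B)" and one: "\<phi> A = B"
    and int: "\<And>C D. C \<in> ?S A \<Longrightarrow> D \<in> ?S A \<Longrightarrow> \<phi> (C \<inter> D) = \<phi> C \<inter> \<phi> D"
    and sd: "\<And>C D. C \<in> ?S A \<Longrightarrow> D \<in> ?S A \<Longrightarrow> \<phi> (sym_diff C D) = sym_diff (\<phi> C) (\<phi> D)"
    using \<phi> by (auto simp: ring_iso_def ring_hom_def principal_ring_def)
  have mem: "\<phi> C \<in> ?S B" if "C \<in> ?S A" for C using bij that by (auto simp: bij_betw_def)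
  have empty: "\<phi> {} = {}" using sd[of "{}" "{}"] by simp
  have diff: "\<phi> (C - D) = \<phi> C - \<phi> D" if "C \<in> ?S A" "D \<in> ?S A" "D \<subseteq> C" for C D
  proof -
    have "sym_diff C D = C - D" "C \<inter> D = D" using that(3) by auto
    then have "\<phi> (C - D) = sym_diff (\<phi> C) (\<phi> D)" "\<phi> D = \<phi> C \<inter> \<phi> D"
      using sd[OF that(1,2)] int[OF that(1,2)] by simp_all
    then show ?thesis by blast
  qed
  define R where "R U V \<longleftrightarrow> U \<in> ?S A \<and> V = \<phi> U" for U V
  have split: "matching R U (\<phi> U) {(U \<inter> C, \<phi> (U \<inter> C)), (U - C, \<phi> (U - C))}"
    if U: "U \<in> ?S A" and C: "C \<in> Co W" for U C
  proof -
    have 1: "U \<inter> C \<in> ?S A" "U - C \<in> ?S A" using U C Co_Int Co_Diff by auto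
    have "\<phi> (U - U \<inter> C) = \<phi> U - \<phi> (U \<inter> C)" by (rule diff[OF U 1(1)]) simp
    then have 2: "\<phi> (U - C) = \<phi> U - \<phi> (U \<inter> C)" by (simp add: Diff_Int)
    have 3: "\<phi> (U \<inter> C) \<subseteq> \<phi> U" using int[OF U 1(1)] by (simp add: Int_absorb1) blast
    have "matching R (U \<inter> C \<union> (U - C)) (\<phi> (U \<inter> C) \<union> \<phi> (U - C))
        ({(U \<inter> C, \<phi> (U \<inter> C))} \<union> {(U - C, \<phi> (U - C))})"
      by (intro matching_Un matching_singleton) (use 1 2 in \<open>auto simp: R_def\<close>)
    moreover have "U \<inter> C \<union> (U - C) = U" "\<phi> (U \<inter> C) \<union> \<phi> (U - C) = \<phi> U" using 2 3 by auto
    ultimately show ?thesis by (simp add: insert_commute)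
  qed
  have "forth R"
    unfolding forth_def
  proof (intro allI impI)
    fix U V C assume "R U V" and C: "C \<in> Co W"
    then have U: "U \<in> ?S A" "V = \<phi> U" by (auto simp: R_def)
    show "\<exists>\<pi>. matching R U V \<pi> \<and> (\<forall>p\<in>\<pi>. decides C (fst p))"
      using split[OF U(1) C] U(2) by (intro exI conjI) (auto simp: decides_def)
  qed
  moreover have "forth R\<inverse>\<inverse>"
    unfolding forth_def
  proof (intro allI impI)
    fix V U D assume "R\<inverse>\<inverse> V U" and D: "D \<in> Co W"
    then have U: "U \<in> ?S A" "V = \<phi> U" by (auto simp: R_def)
    then have V: "V \<in> ?S B" using mem by blast
    then have "V \<inter> D \<in> ?S B" using D Co_Int by auto
    then obtain C where C: "C \<in> ?S A" "V \<inter> D = \<phi> C"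
      using bij_betw_imp_surj_on[OF bij] by (metis (no_types, lifting) imageE)
    have UC: "\<phi> (U \<inter> C) = V \<inter> D" using int[OF U(1) C(1)] U C by auto
    have 1: "U \<inter> C \<in> ?S A" using U C Co_Int by auto
    have "\<phi> (U - U \<inter> C) = \<phi> U - \<phi> (U \<inter> C)" by (rule diff[OF U(1) 1]) simp
    then have "\<phi> (U - C) = V - D" using UC U by (auto simp: Diff_Int)
    then show "\<exists>\<pi>. matching R\<inverse>\<inverse> V U \<pi> \<and> (\<forall>p\<in>\<pi>. decides D (fst p))"
      using matching_swap[OF split[OF U(1), of C]] C U UC
      by (intro exI[of _ "prod.swap ` {(U \<inter> C, \<phi> (U \<inter> C)), (U - C, \<phi> (U - C))}"] conjI)
        (auto simp: decides_def)
  qed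
  moreover have "U \<in> Co W \<and> V \<in> Co W \<and> (U = {} \<longleftrightarrow> V = {})" if "R U V" for U V
  proof -
    have U: "U \<in> ?S A" "V = \<phi> U" using that by (auto simp: R_def)
    have "\<phi> U = \<phi> {} \<longleftrightarrow> U = {}"
      using bij U by (intro inj_on_eq_iff[of \<phi> "?S A"]) (auto simp: bij_betw_def)
    then show ?thesis using U mem empty by auto
  qed
  moreover have "R A B" using A one by (simp add: R_def)
  ultimately obtain f where "co_iso A B f" using back_and_forth[of R A B] by metis
  then show ?thesis unfolding cong_def by blast
qed

text \<open>A local involution extends by the identity, as \<open>K\<close> is both open and closed.\<close>

lemma involution_homeomorphic:
  assumes K: "co_iso K K k" and inv: "\<And>z. z \<in> K \<Longrightarrow> k (k z) = z"
  shows "homeomorphic_map W W (\<lambda>z. if z \<in> K then k z else z)"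
proof -
  define h where "h = (\<lambda>z. if z \<in> K then k z else z)"
  have KC: "K \<in> Co W" and kK: "k ` K = K" using K by (auto simp: co_iso_def bij_betw_def)
  have hh: "h (h z) = z" for z using inv kK by (auto simp: h_def)
  have hC: "h ` C \<in> Co W" if C: "C \<in> Co W" for C
  proof -
    have "h ` C = k ` (C \<inter> K) \<union> (C - K)" by (auto simp: h_def)
    moreover have "k ` (C \<inter> K) \<in> Co W" using K C KC Co_Int by (simp add: co_iso_def)
    ultimately show ?thesis using Co_Un Co_Diff C KC by simp
  qed
  have ht: "h z \<in> topspace W" if "z \<in> topspace W" for z
    using that kK Co_subset_topspace[OF KC] by (auto simp: h_def)
  have "continuous_map W W h"
    unfolding continuous_map
  proof (intro conjI allI impI)
    show "h ` topspace W \<subseteq> topspace W" using ht by blast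
    fix U assume U: "openin W U"
    show "openin W {x \<in> topspace W. h x \<in> U}"
    proof (subst openin_subopen, intro ballI)
      fix x assume "x \<in> {x \<in> topspace W. h x \<in> U}"
      then have x: "x \<in> topspace W" "h x \<in> U" by auto
      obtain C where C: "C \<in> Co W" "h x \<in> C" "C \<subseteq> U" by (rule Co_base[OF U x(2)])
      have "openin W (h ` C)" using Co_openin[OF hC[OF C(1)]] .
      moreover have "x \<in> h ` C" using C(2) hh[of x] by (metis imageI)
      moreover have "h ` C \<subseteq> {x \<in> topspace W. h x \<in> U}"
        using hh C(3) Co_subset_topspace[OF C(1)] ht by auto
      ultimately show "\<exists>T. openin W T \<and> x \<in> T \<and> T \<subseteq> {x \<in> topspace W. h x \<in> U}" by blast
    qed
  qed
  then have "homeomorphic_maps W W h h" using hh by (simp add: homeomorphic_maps_def)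
  then show ?thesis unfolding h_def using homeomorphic_map_maps by blast
qed

lemma homeo_orbit_self: "x \<in> homeo_orbit W x"
  unfolding homeo_orbit_def using homeomorphic_map_id[of W W] by (auto intro!: exI[of _ id])

text \<open>Orbits are a local matter: a homeomorphism between two compact open sets need not extend to
  the whole space, but on a small neighbourhood \<open>A'\<close> of a point \<open>x\<close> that it moves, \<open>A'\<close> is disjoint from
  its image, and exchanging \<open>A'\<close> with its image extends.\<close>

lemma co_iso_orbit:
  assumes f: "co_iso A B f" and x: "x \<in> A"
  shows "f x \<in> homeo_orbit W x"
proof (cases "f x = x")
  case True then show ?thesis using homeo_orbit_self by simp
next
  case False
  have Co: "A \<in> Co W" "B \<in> Co W" and bij: "bij_betw f A B" using f by (auto simp: co_iso_def)
  have inj: "inj_on f A" and im: "f ` A = B" using bij by (auto simp: bij_betw_def)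
  have "x \<in> topspace W" "f x \<in> topspace W"
    using x im Co_subset_topspace[OF Co(1)] Co_subset_topspace[OF Co(2)] by auto
  then obtain C D where CD: "C \<in> Co W" "D \<in> Co W" "x \<in> C" "f x \<in> D" "C \<inter> D = {}"
    using False by (metis Co_separate)
  define E where "E = {a \<in> A. f a \<in> D}"
  have "f ` E = B \<inter> D" using im by (auto simp: E_def)
  then have "f ` E \<in> Co W" using Co_Int Co CD by simp
  moreover have "f ` E \<in> Co W \<longleftrightarrow> E \<in> Co W" using f by (auto simp: co_iso_def E_def)
  ultimately have E: "E \<in> Co W" "E \<subseteq> A" by (auto simp: E_def)
  define A' where "A' = C \<inter> E"
  have A': "A' \<in> Co W" "A' \<subseteq> A" "x \<in> A'" using Co_Int CD E x by (auto simp: A'_def E_def)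
  let ?B = "f ` A'"
  have d: "A' \<inter> ?B = {}" using CD by (auto simp: A'_def E_def)
  have g: "co_iso A' ?B f" by (rule co_iso_restrict[OF f A'(1,2)])
  let ?k = "\<lambda>z. if z \<in> A' then f z else inv_into A' f z"
  have k: "co_iso (A' \<union> ?B) (A' \<union> ?B) ?k"
    using co_iso_glue[OF g co_iso_inv[OF g] d] d by (simp add: Un_commute Int_commute)
  have injA: "inj_on f A'" using inj A'(2) by (rule inj_on_subset)
  have kk: "?k (?k z) = z" if "z \<in> A' \<union> ?B" for z
  proof (cases "z \<in> A'")
    case True
    then have "f z \<notin> A'" using d by blast
    then show ?thesis using True injA by simp
  next
    case False
    then have z: "z \<in> ?B" using that by blast
    then show ?thesis using False inv_into_into[OF z] f_inv_into_f[OF z] by simp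
  qed
  have "homeomorphic_map W W (\<lambda>z. if z \<in> A' \<union> ?B then ?k z else z)"
    by (rule involution_homeomorphic[OF k kk])
  then show ?thesis unfolding homeo_orbit_def using A'(3)
    by (intro CollectI exI[of _ "\<lambda>z. if z \<in> A' \<union> ?B then ?k z else z"]) simp
qed

lemma homeomorphic_co_iso:
  assumes h: "homeomorphic_map W W h" and A: "A \<in> Co W"
  shows "co_iso A (h ` A) h"
proof -
  have sub: "A \<subseteq> topspace W" using Co_subset_topspace A .
  have "inj_on h (topspace W)" using homeomorphic_imp_injective_map[OF h] .
  moreover have "h ` C \<in> Co W \<longleftrightarrow> C \<in> Co W" if "C \<subseteq> A" for C
    using homeomorphic_map_openness[OF h] homeomorphic_map_compactness[OF h] that sub
    by (simp add: Co_def)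
  ultimately show ?thesis
    using A sub by (auto simp: co_iso_def bij_betw_def intro: inj_on_subset)
qed

lemma homeo_orbit_eqI:
  assumes x: "x \<in> topspace W" and y: "y \<in> homeo_orbit W x"
  shows "homeo_orbit W y = homeo_orbit W x"
proof -
  have 1: "homeo_orbit W v \<subseteq> homeo_orbit W u" if v: "v \<in> homeo_orbit W u" for u v
  proof
    obtain g where g: "homeomorphic_map W W g" "v = g u" using v unfolding homeo_orbit_def by blast
    fix z assume "z \<in> homeo_orbit W v"
    then obtain h where h: "homeomorphic_map W W h" "z = h v" unfolding homeo_orbit_def by blast
    have "z = (h \<circ> g) u" using g h by simp
    then show "z \<in> homeo_orbit W u"
      using homeomorphic_map_compose[OF g(1) h(1)] unfolding homeo_orbit_def by blast
  qed
  obtain h where h: "homeomorphic_map W W h" "y = h x" using y unfolding homeo_orbit_def by blast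
  obtain g where g: "homeomorphic_maps W W h g" using h(1) homeomorphic_map_maps by blast
  have "g y = x" using g h(2) x by (simp add: homeomorphic_maps_def)
  moreover have "homeomorphic_map W W g" using g homeomorphic_maps_map by blast
  ultimately have "x \<in> homeo_orbit W y" unfolding homeo_orbit_def by blast
  then show ?thesis using 1 y by blast
qed

end

section \<open>From a rank partition to primitivity\<close>

locale rank_partitioned = omega_stone W for W :: "'a topology" +
  fixes P :: "'p set" and lt :: "'p \<Rightarrow> 'p \<Rightarrow> bool" and X :: "'p \<Rightarrow> 'a set"
  assumes rank: "rank_partition W P lt X"
begin

abbreviation label :: "'a \<Rightarrow> 'p" where
  "label \<equiv> part_label P X"

abbreviation le :: "'p \<Rightarrow> 'p \<Rightarrow> bool" (infix \<open>\<sqsubseteq>\<close> 50) where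
  "p \<sqsubseteq> q \<equiv> po_le lt p q"

lemma complete: "complete_partition W P lt X" and RP1: "RP1 W P lt label" and RP2: "RP2 W P lt label"
  using rank by (auto simp: rank_partition_def)

lemma lt_trans: "lt p q \<Longrightarrow> lt q r \<Longrightarrow> p \<in> P \<Longrightarrow> q \<in> P \<Longrightarrow> r \<in> P \<Longrightarrow> lt p r"
  using complete unfolding complete_partition_def po_system_def by (meson transp_onD)

lemma le_antisym: "p \<sqsubseteq> q \<Longrightarrow> q \<sqsubseteq> p \<Longrightarrow> p \<in> P \<Longrightarrow> q \<in> P \<Longrightarrow> p = q"
  using complete unfolding complete_partition_def po_system_def po_le_def by (meson antisymp_onD)

lemma le_trans: "p \<sqsubseteq> q \<Longrightarrow> q \<sqsubseteq> r \<Longrightarrow> p \<in> P \<Longrightarrow> q \<in> P \<Longrightarrow> r \<in> P \<Longrightarrow> p \<sqsubseteq> r"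
  using lt_trans by (auto simp: po_le_def)

lemma part_subset: "p \<in> P \<Longrightarrow> X p \<subseteq> topspace W"
  using complete unfolding complete_partition_def by (elim conjE) (drule sym, auto)

lemma part_disjoint: "disjoint_family_on X P" and part_cover: "(\<Union>p\<in>P. X p) = topspace W"
  using complete by (simp_all add: complete_partition_def)

lemma label_eq: "p \<in> P \<Longrightarrow> w \<in> X p \<Longrightarrow> label w = p"
  by (rule part_label_eq[OF part_disjoint])

lemma label_in: assumes "w \<in> topspace W" shows "label w \<in> P" "w \<in> X (label w)"
proof -
  obtain p where p: "p \<in> P" "w \<in> X p" using assms unfolding part_cover[symmetric] by (rule UN_E)
  then show "label w \<in> P" "w \<in> X (label w)" using label_eq[OF p] by simp_all
qed

lemma part_iff: "p \<in> P \<Longrightarrow> w \<in> topspace W \<Longrightarrow> w \<in> X p \<longleftrightarrow> label w = p"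
  using label_eq label_in by blast

lemma derived_part:
  assumes p: "p \<in> P"
  shows "W derived_set_of X p = {w \<in> topspace W. lt (label w) p}"
proof -
  have "W derived_set_of X p = (\<Union>q\<in>{q\<in>P. lt q p}. X q)"
    using complete p by (simp add: complete_partition_def)
  also have "\<dots> = {w \<in> topspace W. lt (label w) p}"
  proof (intro equalityI subsetI)
    fix w assume "w \<in> (\<Union>q\<in>{q\<in>P. lt q p}. X q)"
    then obtain q where q: "q \<in> P" "lt q p" "w \<in> X q" by auto
    then show "w \<in> {w \<in> topspace W. lt (label w) p}"
      using label_eq[OF q(1,3)] part_subset[OF q(1)] by auto
  next
    fix w assume "w \<in> {w \<in> topspace W. lt (label w) p}"
    then show "w \<in> (\<Union>q\<in>{q\<in>P. lt q p}. X q)"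
      using label_in[of w] by (auto intro!: UN_I[of "label w"])
  qed
  finally show ?thesis .
qed

text \<open>This set is the closure of a part. So labels can only drop in a limit, and ``at most \<open>p\<close>'' is
  a closed condition for every \<open>p\<close>.\<close>

lemma closedin_below:
  assumes p: "p \<in> P"
  shows "closedin W {w \<in> topspace W. label w \<sqsubseteq> p}"
proof -
  have "W closure_of X p = {w \<in> topspace W. label w \<sqsubseteq> p}"
    using derived_part[OF p] part_iff[OF p] part_subset[OF p]
    by (auto simp: closure_of po_le_def)
  then show ?thesis using closedin_closure_of by metis
qed

text \<open>For separated \<open>q\<close> the condition ``at least \<open>q\<close>'' is open, which is the whole use of the first
  axiom of rank partitions. If it fails at \<open>x\<close>, there is a sequence converging to \<open>x\<close> whose labels are
  not above \<open>q\<close>. By Ramsey's theorem the labels may be taken to be pairwise incomparable, or strictly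
  increasing, or to lie all below the first one. The axiom excludes the first two patterns; in the
  third, the label of \<open>x\<close>, hence also \<open>q\<close>, lies below the label of the first member.\<close>

lemma openin_above_separated:
  assumes q: "separated_in P lt q"
  shows "openin W {w \<in> topspace W. q \<sqsubseteq> label w}"
proof (subst openin_subopen, intro ballI)
  have qP: "q \<in> P" using q by (simp add: separated_in_def)
  let ?U = "{w \<in> topspace W. q \<sqsubseteq> label w}"
  fix x assume "x \<in> ?U"
  then have x: "x \<in> topspace W" "q \<sqsubseteq> label x" by auto
  obtain N where N: "\<And>n. N n \<in> Co W" "\<And>n. x \<in> N n" "\<And>n. N (Suc n) \<subseteq> N n"
    "\<And>U. openin W U \<Longrightarrow> x \<in> U \<Longrightarrow> \<exists>n. N n \<subseteq> U"
    using Co_nbhd_seq[OF x(1)] by metis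
  show "\<exists>T. openin W T \<and> x \<in> T \<and> T \<subseteq> ?U"
  proof (cases "\<exists>n. N n \<subseteq> ?U")
    case True
    then show ?thesis using N(1,2) Co_openin by blast
  next
    case False
    have "\<forall>n. \<exists>y. y \<in> N n \<and> \<not> q \<sqsubseteq> label y"
      using False Co_subset_topspace[OF N(1)] by blast
    then obtain y where y: "\<And>n. y n \<in> N n" "\<And>n. \<not> q \<sqsubseteq> label (y n)" by metis
    have yt: "y n \<in> topspace W" for n using y(1) Co_subset_topspace[OF N(1)] by blast
    \<comment> \<open>0: incomparable; 1: strictly increasing; 2: the later label is below the earlier one\<close>
    define c :: "nat \<Rightarrow> nat \<Rightarrow> nat" where
      "c i j = (if strictly_incomparable lt (label (y i)) (label (y j)) then 0
                else if po_lneq lt (label (y i)) (label (y j)) then 1 else 2)" for i j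
    have "\<exists>Y t. Y \<subseteq> UNIV \<and> infinite Y \<and> t < (3::nat) \<and>
        (\<forall>i\<in>Y. \<forall>j\<in>Y. i \<noteq> j \<longrightarrow> (\<lambda>S. c (Min S) (Max S)) {i, j} = t)"
      by (rule Ramsey2) (auto simp: c_def)
    then obtain Y t where Y: "infinite Y" "t < (3::nat)"
      "\<And>i j. i \<in> Y \<Longrightarrow> j \<in> Y \<Longrightarrow> i \<noteq> j \<Longrightarrow> c (Min {i, j}) (Max {i, j}) = t" by blast
    define xs where "xs k = y (enumerate Y k)" for k
    have mono: "enumerate Y i < enumerate Y j" if "i < j" for i j
      using that strict_mono_enumerate[OF Y(1)] by (simp add: strict_mono_def)
    have ct: "c (enumerate Y i) (enumerate Y j) = t" if "i < j" for i j
      using Y(3)[of "enumerate Y i" "enumerate Y j"] mono[OF that] enumerate_in_set[OF Y(1)]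
      by (simp add: min_def max_def)
    have xs: "xs k \<in> topspace W" "\<not> q \<sqsubseteq> label (xs k)" for k using y yt by (auto simp: xs_def)
    have lim: "limitin W xs x sequentially"
    proof (rule limitin_nbhd_seq[OF x(1) N(3,4)])
      fix k
      have "k \<le> enumerate Y k" using strict_mono_enumerate[OF Y(1)] by (rule strict_mono_imp_increasing)
      then have "N (enumerate Y k) \<subseteq> N k" using N(3) by (rule lift_Suc_antimono_le[rotated])
      then show "xs k \<in> N k" using y(1) unfolding xs_def by blast
    qed
    have sym: "strictly_incomparable lt a b \<longleftrightarrow> strictly_incomparable lt b a" for a b
      by (auto simp: strictly_incomparable_def)
    consider "t = 0" | "t = 1" | "t = 2" using Y(2) by linarith
    then have False
    proof cases
      case 1
      have "strictly_incomparable lt (label (xs i)) (label (xs j))" if "i \<noteq> j" for i j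
        using ct[of i j] ct[of j i] that 1 sym
        by (cases i j rule: linorder_cases) (auto simp: c_def xs_def split: if_splits)
      then have "\<forall>\<^sub>F k in sequentially. q \<sqsubseteq> label (xs k)"
        using RP1 q x lim xs(1) unfolding RP1_def by blast
      then show False using xs(2) by (auto simp: eventually_sequentially)
    next
      case 2
      have "strictly_increasing lt (\<lambda>k. label (xs k))"
        unfolding strictly_increasing_def
      proof (rule monotoneI)
        fix i j :: nat assume "i < j"
        then have "c (enumerate Y i) (enumerate Y j) = 1" using ct 2 by simp
        then show "po_lneq lt (label (xs i)) (label (xs j))"
          by (simp add: c_def xs_def split: if_splits)
      qed
      then have "\<forall>\<^sub>F k in sequentially. q \<sqsubseteq> label (xs k)"
        using RP1 q x lim xs(1) unfolding RP1_def by blast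
      then show False using xs(2) by (auto simp: eventually_sequentially)
    next
      case 3
      have "label (xs k) \<sqsubseteq> label (xs 0)" for k
        using ct[of 0 k] 3
        by (cases "k = 0") (auto simp: c_def xs_def po_le_def po_lneq_def strictly_incomparable_def split: if_splits)
      then have "\<forall>\<^sub>F k in sequentially. xs k \<in> {w \<in> topspace W. label w \<sqsubseteq> label (xs 0)}"
        using xs(1) by simp
      then have "x \<in> {w \<in> topspace W. label w \<sqsubseteq> label (xs 0)}"
        by (rule limitin_closedin[OF lim closedin_below[OF label_in(1)[OF xs(1)]]]) simp
      then have "q \<sqsubseteq> label (xs 0)" using x xs(1) label_in qP le_trans by blast
      then show False using xs(2) by blast
    qed
    then show ?thesis ..
  qed
qed

text \<open>A trim set of type \<open>q\<close> looks like a neighbourhood of a point labelled \<open>q\<close>: the label \<open>q\<close> is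
  the least one that occurs, and it occurs only once unless the points labelled \<open>q\<close> accumulate at
  each other. Trim sets turn out to be the pseudo-indecomposable sets.\<close>

definition trim :: "'p \<Rightarrow> 'a set \<Rightarrow> bool" where
  "trim q U \<longleftrightarrow> U \<in> Co W \<and> separated_in P lt q \<and> (\<forall>u\<in>U. q \<sqsubseteq> label u) \<and> (\<exists>u\<in>U. label u = q) \<and>
     (lt q q \<or> (\<forall>u\<in>U. \<forall>v\<in>U. label u = q \<longrightarrow> label v = q \<longrightarrow> u = v))"

lemma trim_Co: "trim q U \<Longrightarrow> U \<in> Co W"
  and trim_P: "trim q U \<Longrightarrow> q \<in> P"
  and trim_le: "trim q U \<Longrightarrow> u \<in> U \<Longrightarrow> q \<sqsubseteq> label u"
  by (auto simp: trim_def separated_in_def)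

text \<open>Cutting a trim set in two leaves a trim set of the same type on the side that keeps a point of
  minimal label. This is the source of pseudo-indecomposability.\<close>

lemma trim_subset:
  "trim q U \<Longrightarrow> B \<in> Co W \<Longrightarrow> B \<subseteq> U \<Longrightarrow> u \<in> B \<Longrightarrow> label u = q \<Longrightarrow> trim q B"
  unfolding trim_def by blast

lemma part_isolated:
  assumes q: "q \<in> P" and x: "x \<in> topspace W" "\<not> lt (label x) q"
  obtains T where "openin W T" "x \<in> T" "\<And>y. y \<in> T \<Longrightarrow> label y = q \<Longrightarrow> y = x"
proof -
  have "x \<notin> W derived_set_of X q" using x derived_part[OF q] by simp
  then obtain T where T: "x \<in> T" "openin W T" "\<And>y. y \<noteq> x \<Longrightarrow> y \<in> X q \<Longrightarrow> y \<notin> T"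
    using x unfolding derived_set_of_def by blast
  have "y = x" if "y \<in> T" "label y = q" for y
    using T(3) that label_in[of y] openin_subset[OF T(2)] by blast
  then show thesis using that T by blast
qed

lemma trim_nbhd:
  assumes sep: "separated_in P lt (label x)" and x: "x \<in> topspace W" and N: "openin W N" "x \<in> N"
  obtains U where "trim (label x) U" "x \<in> U" "U \<subseteq> N"
proof -
  let ?q = "label x" and ?O = "N \<inter> {w \<in> topspace W. label x \<sqsubseteq> label w}"
  have qP: "?q \<in> P" using label_in x by simp
  have O: "openin W ?O" "x \<in> ?O"
    using N openin_above_separated[OF sep] x by (auto simp: po_le_def)
  show thesis
  proof (cases "lt ?q ?q")
    case True
    obtain C where C: "C \<in> Co W" "x \<in> C" "C \<subseteq> ?O" by (rule Co_base[OF O])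
    have "trim ?q C" unfolding trim_def using C sep True by blast
    then show thesis using that C by blast
  next
    case False
    obtain T where T: "openin W T" "x \<in> T" "\<And>y. y \<in> T \<Longrightarrow> label y = ?q \<Longrightarrow> y = x"
      using part_isolated[OF qP x False] by metis
    have "openin W (T \<inter> ?O)" "x \<in> T \<inter> ?O" using T O by (auto intro: openin_Int)
    then obtain C where C: "C \<in> Co W" "x \<in> C" "C \<subseteq> T \<inter> ?O" by (rule Co_base)
    have "u = x" if "u \<in> C" "label u = ?q" for u using T(3) C(3) that by blast
    then have "trim ?q C" unfolding trim_def using C sep by blast
    then show thesis using that C by blast
  qed
qed

text \<open>A trim set can be enlarged by a small neighbourhood of any point with a larger label, however
  far away that point is: near it all labels are above \<open>r\<close> and none is equal to \<open>r\<close>.\<close>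

lemma trim_extend:
  assumes U: "trim r U" and x: "x \<in> topspace W" "r \<sqsubseteq> label x" "label x \<noteq> r" and N: "openin W N" "x \<in> N"
  obtains V where "trim r V" "x \<in> V" "V \<subseteq> U \<union> N"
proof -
  have sep: "separated_in P lt r" and rP: "r \<in> P" using U trim_P by (auto simp: trim_def)
  have "\<not> lt (label x) r"
    using le_antisym[OF x(2)] x label_in rP by (auto simp: po_le_def)
  then obtain T where T: "openin W T" "x \<in> T" "\<And>y. y \<in> T \<Longrightarrow> label y = r \<Longrightarrow> y = x"
    using part_isolated[OF rP x(1)] by metis
  let ?O = "T \<inter> (N \<inter> {w \<in> topspace W. r \<sqsubseteq> label w})"
  have "openin W ?O" "x \<in> ?O"
    using N T openin_above_separated[OF sep] x by (auto intro: openin_Int)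
  then obtain C where C: "C \<in> Co W" "x \<in> C" "C \<subseteq> ?O" by (rule Co_base)
  have no: "label u \<noteq> r" if "u \<in> C" for u using T(3) C(3) that x(3) by blast
  have "U \<union> C \<in> Co W" using C(1) trim_Co[OF U] Co_Un by blast
  moreover have "\<forall>u\<in>U \<union> C. r \<sqsubseteq> label u" using C(3) trim_le[OF U] by blast
  ultimately have "trim r (U \<union> C)"
    using U no unfolding trim_def by blast
  then show thesis using that C by blast
qed

lemma finite_chain_least:
  assumes "finite C" "C \<noteq> {}" "C \<subseteq> P" "\<And>a b. a \<in> C \<Longrightarrow> b \<in> C \<Longrightarrow> a \<sqsubseteq> b \<or> b \<sqsubseteq> a"
  shows "\<exists>p\<in>C. \<forall>a\<in>C. p \<sqsubseteq> a"
  using assms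
proof (induction rule: finite_ne_induct)
  case (singleton x) then show ?case by (simp add: po_le_def)
next
  case (insert x F)
  then obtain p where p: "p \<in> F" "\<forall>a\<in>F. p \<sqsubseteq> a" by blast
  show ?case
  proof (cases "p \<sqsubseteq> x")
    case True then show ?thesis using p by blast
  next
    case False
    then have xp: "x \<sqsubseteq> p" using insert.prems p by blast
    have "x \<sqsubseteq> a" if "a \<in> F" for a
      using le_trans[OF xp, of a] p that insert.prems(1) by blast
    then show ?thesis by (auto simp: po_le_def)
  qed
qed

text \<open>Zorn's lemma applies because the sets of points with label at most \<open>p\<close> are closed, so
  that compactness provides lower bounds of chains.\<close>

lemma minimal_label:
  assumes F: "compactin W F" "F \<noteq> {}"
  obtains x where "x \<in> F" "\<And>y. y \<in> F \<Longrightarrow> label y \<sqsubseteq> label x \<Longrightarrow> label y = label x"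
proof -
  let ?S = "label ` F" and ?ge = "\<lambda>a b. b \<sqsubseteq> a"
  have Ft: "F \<subseteq> topspace W" using F(1) by (rule compactin_subset_topspace)
  have SP: "?S \<subseteq> P" using Ft label_in by blast
  have "\<exists>m\<in>?S. \<forall>a\<in>?S. ?ge m a \<longrightarrow> a = m"
  proof (rule predicate_Zorn)
    show "partial_order_on ?S (relation_of ?ge ?S)"
    proof (rule partial_order_on_relation_ofI)
      show "?ge a a" for a by (simp add: po_le_def)
      show "?ge a c" if "a \<in> ?S" "b \<in> ?S" "c \<in> ?S" "?ge a b" "?ge b c" for a b c
        using le_trans[of c b a] that SP by blast
      show "a = b" if "a \<in> ?S" "b \<in> ?S" "?ge a b" "?ge b a" for a b
        using le_antisym[of a b] that SP by blast
    qed
    fix C assume "C \<in> Chains (relation_of ?ge ?S)"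
    then have "\<forall>a\<in>C. \<forall>b\<in>C. a \<in> ?S \<and> (a \<sqsubseteq> b \<or> b \<sqsubseteq> a)"
      by (simp add: Chains_def relation_of_def) blast
    then have C: "\<And>a b. a \<in> C \<Longrightarrow> b \<in> C \<Longrightarrow> a \<in> ?S \<and> (a \<sqsubseteq> b \<or> b \<sqsubseteq> a)" by simp
    have CP: "C \<subseteq> P" using C SP by blast
    let ?B = "\<lambda>p. {w \<in> topspace W. label w \<sqsubseteq> p}"
    have "F \<inter> \<Inter>(?B ` C) \<noteq> {}"
    proof -
      have "\<forall>K\<in>?B ` C. closedin W K" using closedin_below CP by blast
      moreover have "F \<inter> \<Inter>\<F> \<noteq> {}" if \<F>: "finite \<F> \<and> \<F> \<subseteq> ?B ` C" for \<F>
      proof -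
        have "\<exists>C0\<subseteq>C. finite C0 \<and> \<F> = ?B ` C0"
          by (rule finite_subset_image) (use \<F> in simp_all)
        then obtain C0 where C0: "C0 \<subseteq> C" "finite C0" "\<F> = ?B ` C0" by (elim exE conjE)
        show ?thesis
        proof (cases "C0 = {}")
          case True then show ?thesis using F(2) C0 by simp
        next
          case False
          have "\<exists>p\<in>C0. \<forall>a\<in>C0. p \<sqsubseteq> a"
            by (rule finite_chain_least[OF C0(2) False]) (use C0 CP C in blast)+
          then obtain p where p: "p \<in> C0" "\<forall>a\<in>C0. p \<sqsubseteq> a" by blast
          then obtain w where "w \<in> F" "label w = p" using C[of p p] C0 by blast
          then have "w \<in> F \<inter> \<Inter>\<F>" using p C0 Ft by auto
          then show ?thesis by blast
        qed
      qed
      ultimately show ?thesis using F(1) unfolding compactin_fip by blast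
    qed
    then obtain w where "w \<in> F" "\<forall>p\<in>C. label w \<sqsubseteq> p" by blast
    then show "\<exists>u\<in>?S. \<forall>a\<in>C. ?ge a u" by blast
  qed
  then show thesis using that by blast
qed

text \<open>Otherwise take a point \<open>x\<close> of minimal label among the points of \<open>A\<close> that lie in no trim subset
  of \<open>A\<close>. If its label is separated, \<open>x\<close> has a trim neighbourhood. If not, the second axiom of rank
  partitions yields points of strictly smaller label near \<open>x\<close>; these lie in trim subsets by minimality,
  and such a trim subset can be enlarged to contain \<open>x\<close>.\<close>

lemma trim_cover:
  assumes A: "A \<in> Co W" and a: "a \<in> A"
  shows "\<exists>r U. trim r U \<and> a \<in> U \<and> U \<subseteq> A"
proof (rule ccontr)
  assume no: "\<not> ?thesis"
  let ?T = "{U. U \<subseteq> A \<and> (\<exists>r. trim r U)}"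
  define F where "F = A - \<Union>?T"
  have "openin W (\<Union>?T)" by (rule openin_Union) (auto dest: trim_Co Co_openin)
  then have "closedin W F" unfolding F_def using Co_closedin[OF A] by (rule closedin_diff[rotated])
  then have "compactin W F"
    using closed_compactin[OF Co_compactin[OF A]] by (auto simp: F_def)
  moreover have "F \<noteq> {}" using no a by (auto simp: F_def)
  ultimately obtain x where x: "x \<in> F" and
    min: "\<And>y. y \<in> F \<Longrightarrow> label y \<sqsubseteq> label x \<Longrightarrow> label y = label x"
    using minimal_label by metis
  have xA: "x \<in> A" and xT: "\<And>r U. trim r U \<Longrightarrow> U \<subseteq> A \<Longrightarrow> x \<notin> U" using x by (auto simp: F_def)
  have xt: "x \<in> topspace W" using xA Co_subset_topspace[OF A] by blast
  show False
  proof (cases "separated_in P lt (label x)")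
    case True
    then obtain U where "trim (label x) U" "x \<in> U" "U \<subseteq> A"
      by (rule trim_nbhd[OF _ xt Co_openin[OF A] xA])
    then show False using xT by blast
  next
    case False
    then obtain xs where xs: "range xs \<subseteq> topspace W" "limitin W xs x sequentially"
      "\<And>k. po_lneq lt (label (xs k)) (label x)"
      using RP2 xt unfolding RP2_def by blast
    have "\<forall>\<^sub>F k in sequentially. xs k \<in> A"
      using xs(2) Co_openin[OF A] xA unfolding limitin_def by blast
    then obtain k where k: "xs k \<in> A" by (auto simp: eventually_sequentially)
    have kl: "label (xs k) \<sqsubseteq> label x" "label (xs k) \<noteq> label x" using xs(3) by (auto simp: po_lneq_def)
    have kt: "xs k \<in> topspace W" using xs(1) by blast
    have "xs k \<notin> F" using min kl by blast
    then obtain r U where U: "trim r U" "U \<subseteq> A" "xs k \<in> U" using k by (auto simp: F_def)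
    have rk: "r \<sqsubseteq> label (xs k)" using trim_le[OF U(1,3)] .
    have P: "r \<in> P" "label (xs k) \<in> P" "label x \<in> P" using trim_P[OF U(1)] label_in kt xt by auto
    have rx: "r \<sqsubseteq> label x" using le_trans[OF rk kl(1)] P by blast
    have rne: "label x \<noteq> r" using le_antisym[OF kl(1)] rk kl(2) P by blast
    obtain V where "trim r V" "x \<in> V" "V \<subseteq> U \<union> A"
      by (rule trim_extend[OF U(1) xt rx rne Co_openin[OF A] xA])
    then show False using xT U(2) by blast
  qed
qed

definition trim_family :: "'a set set \<Rightarrow> 'a set \<Rightarrow> bool" where
  "trim_family D A \<longleftrightarrow> finite D \<and> pairwise disjnt D \<and> \<Union>D = A \<and> (\<forall>U\<in>D. \<exists>r. trim r U)"

text \<open>The part of \<open>U\<close> outside \<open>A\<close> is again trim if it contains a point of minimal label. If not, such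
  a point lies in a member \<open>V\<close> of the family, whose type is at most \<open>r\<close>, and then \<open>V\<close> can swallow the
  remainder of \<open>U\<close> without changing its type.\<close>

lemma trim_family_add:
  assumes D: "trim_family D A" and U: "trim r U"
  shows "\<exists>D'. trim_family D' (A \<union> U)"
proof -
  have fin: "finite D" and dj: "pairwise disjnt D" and un: "\<Union>D = A" and tr: "\<And>V. V \<in> D \<Longrightarrow> \<exists>r. trim r V"
    using D by (auto simp: trim_family_def)
  have "A \<in> Co W" using Co_Union[OF fin] tr trim_Co un by blast
  then have UA: "U - A \<in> Co W" using Co_Diff trim_Co[OF U] by blast
  show ?thesis
  proof (cases "\<exists>u\<in>U - A. label u = r")
    case True
    then have "trim r (U - A)" using trim_subset[OF U UA] by blast
    moreover have "disjnt (U - A) V" if "V \<in> D" for V using that un by (auto simp: disjnt_def)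
    ultimately have "trim_family (insert (U - A) D) (A \<union> U)"
      using fin dj un tr by (auto simp: trim_family_def pairwise_insert disjnt_sym)
    then show ?thesis ..
  next
    case False
    obtain u where u: "u \<in> U" "label u = r" using U by (auto simp: trim_def)
    then obtain V where V: "V \<in> D" "u \<in> V" using False un by blast
    obtain s where s: "trim s V" using tr V by blast
    have sr: "s \<sqsubseteq> r" using trim_le[OF s V(2)] u by simp
    have P: "s \<in> P" "r \<in> P" using trim_P s U by auto
    have ne: "label v \<noteq> s" if v: "v \<in> U - A" for v
    proof
      assume "label v = s"
      then have "r \<sqsubseteq> s" using trim_le[OF U, of v] v by auto
      then have "r = s" using le_antisym[OF _ sr] P by blast
      then show False using False v \<open>label v = s\<close> by blast
    qed
    have "s \<sqsubseteq> label v" if v: "v \<in> U - A" for v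
    proof -
      have "v \<in> topspace W" using v Co_subset_topspace[OF trim_Co[OF U]] by blast
      then show ?thesis using le_trans[OF sr trim_le[OF U, of v]] v P label_in by blast
    qed
    then have V': "trim s (V \<union> (U - A))"
      using s ne Co_Un[OF trim_Co[OF s] UA] unfolding trim_def by blast
    have dV: "disjnt V' V" if "V' \<in> D - {V}" for V'
      using dj that V(1) by (auto simp: pairwise_def)
    have "trim_family (insert (V \<union> (U - A)) (D - {V})) (A \<union> U)"
      unfolding trim_family_def
    proof (intro conjI)
      show "finite (insert (V \<union> (U - A)) (D - {V}))" using fin by simp
      show "pairwise disjnt (insert (V \<union> (U - A)) (D - {V}))"
        unfolding pairwise_insert
      proof (intro conjI allI impI)
        fix V' assume "V' \<in> D - {V} \<and> V' \<noteq> V \<union> (U - A)"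
        then have "disjnt V' V" "V' \<subseteq> A" using dV un by auto
        then show "disjnt (V \<union> (U - A)) V'" "disjnt V' (V \<union> (U - A))" by (auto simp: disjnt_def)
      qed (rule pairwise_subset[OF dj], blast)
      show "\<Union>(insert (V \<union> (U - A)) (D - {V})) = A \<union> U" using un V(1) by blast
      show "\<forall>V'\<in>insert (V \<union> (U - A)) (D - {V}). \<exists>r. trim r V'" using V' tr by blast
    qed
    then show ?thesis ..
  qed
qed

lemma trim_family_exists:
  assumes A: "A \<in> Co W"
  shows "\<exists>D. trim_family D A"
proof -
  let ?T = "{U. U \<subseteq> A \<and> (\<exists>r. trim r U)}"
  have "A \<subseteq> \<Union>?T" using trim_cover[OF A] by blast
  moreover have "\<forall>U\<in>?T. openin W U" using trim_Co Co_openin by blast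
  ultimately have "\<exists>\<F>. finite \<F> \<and> \<F> \<subseteq> ?T \<and> A \<subseteq> \<Union>\<F>"
    by (intro compactinD[OF Co_compactin[OF A]]) blast+
  then obtain \<F> where \<F>: "finite \<F>" "\<F> \<subseteq> ?T" "A \<subseteq> \<Union>\<F>" by (elim exE conjE)
  have "\<exists>D. trim_family D (\<Union>\<F>)"
    using \<F>(1,2)
  proof (induction rule: finite_induct)
    case empty
    have "trim_family {} (\<Union>{})" by (simp add: trim_family_def)
    then show ?case ..
  next
    case (insert U F)
    then obtain D r where "trim_family D (\<Union>F)" "trim r U" by blast
    then have "\<exists>D'. trim_family D' (\<Union>F \<union> U)" by (rule trim_family_add)
    then show ?case by (simp add: Un_commute)
  qed
  moreover have "\<Union>\<F> = A" using \<F> by blast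
  ultimately show ?thesis by simp
qed

definition same_trim :: "'a set \<Rightarrow> 'a set \<Rightarrow> bool" where
  "same_trim U V \<longleftrightarrow> (\<exists>q. trim q U \<and> trim q V)"

text \<open>The type \<open>q\<close> point of \<open>Y\<close> is a limit of points labelled \<open>r\<close>, so there is room for a trim set of
  type \<open>r\<close> that avoids it.\<close>

lemma trim_split_off:
  assumes Y: "trim q Y" and r: "separated_in P lt r" and qr: "lt q r"
  obtains V where "trim r V" "V \<subseteq> Y" "trim q (Y - V)"
proof -
  have rP: "r \<in> P" using r by (simp add: separated_in_def)
  obtain v where v: "v \<in> Y" "label v = q" using Y by (auto simp: trim_def)
  have vt: "v \<in> topspace W" using v(1) Co_subset_topspace[OF trim_Co[OF Y]] by blast
  have "v \<in> W derived_set_of X r" using derived_part[OF rP] v vt qr by simp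
  then obtain u where u: "u \<noteq> v" "u \<in> X r" "u \<in> Y"
    using v(1) Co_openin[OF trim_Co[OF Y]] unfolding derived_set_of_def by blast
  have ut: "u \<in> topspace W" and ul: "label u = r" using u part_subset[OF rP] label_eq[OF rP] by auto
  obtain C D where CD: "C \<in> Co W" "D \<in> Co W" "u \<in> C" "v \<in> D" "C \<inter> D = {}"
    by (rule Co_separate[OF ut vt u(1)])
  have "openin W (Y \<inter> C)" "u \<in> Y \<inter> C"
    using Co_openin[OF Co_Int[OF trim_Co[OF Y] CD(1)]] u CD by auto
  then obtain V where V: "trim r V" "u \<in> V" "V \<subseteq> Y \<inter> C"
    using trim_nbhd[of u "Y \<inter> C"] r ul ut by metis
  have "trim q (Y - V)"
    by (rule trim_subset[OF Y Co_Diff[OF trim_Co[OF Y] trim_Co[OF V(1)]] _ _ v(2)]) (use V CD v in blast)+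
  then show thesis using that V by blast
qed

text \<open>Copies of the members of \<open>D\<close> are split off from \<open>Y\<close> one after the other; what remains of \<open>Y\<close> is
  still trim of type \<open>q\<close> and is matched with \<open>X1\<close>.\<close>

lemma trim_match_family:
  assumes "finite D" "pairwise disjnt D" "\<And>U. U \<in> D \<Longrightarrow> disjnt U X1"
    "\<And>U. U \<in> D \<Longrightarrow> \<exists>r. trim r U \<and> lt q r" "trim q X1" "trim q Y"
  shows "\<exists>\<pi>. matching same_trim (X1 \<union> \<Union>D) Y \<pi> \<and> fst ` \<pi> \<subseteq> insert X1 D"
  using assms
proof (induction arbitrary: Y rule: finite_induct)
  case empty
  have "matching same_trim X1 Y {(X1, Y)}"
    using empty by (intro matching_singleton) (auto simp: same_trim_def)
  then show ?case by (intro exI[of _ "{(X1, Y)}"]) simp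
next
  case (insert U D)
  obtain r where r: "trim r U" "lt q r" using insert.prems by blast
  then have "separated_in P lt r" by (simp add: trim_def)
  then obtain V where V: "trim r V" "V \<subseteq> Y" "trim q (Y - V)"
    by (rule trim_split_off[OF insert.prems(5) _ r(2)])
  have "\<exists>\<pi>. matching same_trim (X1 \<union> \<Union>D) (Y - V) \<pi> \<and> fst ` \<pi> \<subseteq> insert X1 D"
    by (rule insert.IH) (use insert.prems V in \<open>auto simp: pairwise_insert\<close>)
  then obtain \<pi> where \<pi>: "matching same_trim (X1 \<union> \<Union>D) (Y - V) \<pi>" "fst ` \<pi> \<subseteq> insert X1 D" by blast
  have "U \<inter> (X1 \<union> \<Union>D) = {}"
    using insert.prems(1,2) insert.hyps by (auto simp: pairwise_insert disjnt_def)
  moreover have "same_trim U V" using r V by (auto simp: same_trim_def)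
  ultimately have "matching same_trim (U \<union> (X1 \<union> \<Union>D)) (V \<union> (Y - V)) ({(U, V)} \<union> \<pi>)"
    by (intro matching_Un matching_singleton \<pi>) auto
  moreover have "U \<union> (X1 \<union> \<Union>D) = X1 \<union> \<Union>(insert U D)" "V \<union> (Y - V) = Y" using V by auto
  ultimately show ?case using \<pi>(2) by (intro exI[of _ "{(U, V)} \<union> \<pi>"]) auto
qed

text \<open>Both halves of \<open>A\<close> decompose into trim sets. One of them contains a point of label \<open>q\<close> and has
  type \<open>q\<close>; all others have types related to \<open>q\<close> by \<open>lt\<close>: a second member of type \<open>q\<close> is possible only
  if \<open>lt q q\<close>.\<close>

lemma forth_same_trim: "forth same_trim"
  unfolding forth_def
proof (intro allI impI)
  fix A B C assume "same_trim A B" and C: "C \<in> Co W"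
  then obtain q where A: "trim q A" and B: "trim q B" by (auto simp: same_trim_def)
  have qP: "q \<in> P" using trim_P A .
  obtain D1 where D1: "trim_family D1 (A \<inter> C)"
    using trim_family_exists[OF Co_Int[OF trim_Co[OF A] C]] by blast
  obtain D2 where D2: "trim_family D2 (A - C)"
    using trim_family_exists[OF Co_Diff[OF trim_Co[OF A] C]] by blast
  let ?D = "D1 \<union> D2"
  have in1: "U \<subseteq> A \<inter> C" if "U \<in> D1" for U using D1 that by (auto simp: trim_family_def)
  have in2: "U \<subseteq> A - C" if "U \<in> D2" for U using D2 that by (auto simp: trim_family_def)
  have dec: "decides C U" if "U \<in> ?D" for U using in1 in2 that by (auto simp: decides_def)
  have un: "\<Union>?D = A" using D1 D2 by (auto simp: trim_family_def)
  have fin: "finite ?D" using D1 D2 by (simp add: trim_family_def)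
  have tr: "\<exists>r. trim r U" if "U \<in> ?D" for U using D1 D2 that by (auto simp: trim_family_def)
  have dj: "disjnt U V" if UV: "U \<in> ?D" "V \<in> ?D" "U \<noteq> V" for U V
  proof -
    consider "U \<in> D1" "V \<in> D1" | "U \<in> D2" "V \<in> D2" | "U \<in> D1" "V \<in> D2" | "U \<in> D2" "V \<in> D1"
      using UV by blast
    then show ?thesis
    proof cases
      case 1 then show ?thesis using D1 UV(3) by (simp add: trim_family_def pairwise_def)
    next
      case 2 then show ?thesis using D2 UV(3) by (simp add: trim_family_def pairwise_def)
    next
      case 3 then show ?thesis using in1[of U] in2[of V] by (auto simp: disjnt_def)
    next
      case 4 then show ?thesis using in1[of V] in2[of U] by (auto simp: disjnt_def)
    qed
  qed
  obtain x where x: "x \<in> A" "label x = q" using A by (auto simp: trim_def)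
  then obtain X1 where X1: "X1 \<in> ?D" "x \<in> X1" using un by blast
  have "X1 \<in> Co W" "X1 \<subseteq> A" using tr[OF X1(1)] trim_Co un X1 by auto
  then have tX1: "trim q X1" using trim_subset[OF A _ _ X1(2) x(2)] by blast
  have above: "\<exists>r. trim r U \<and> lt q r" if U: "U \<in> ?D - {X1}" for U
  proof -
    obtain r where r: "trim r U" using tr U by blast
    then obtain u where u: "u \<in> U" "label u = r" by (auto simp: trim_def)
    have uA: "u \<in> A" using u(1) U un by blast
    have "lt q r"
    proof (rule ccontr)
      assume n: "\<not> lt q r"
      then have "r = q" using trim_le[OF A uA] u(2) by (auto simp: po_le_def)
      then have "u = x" using A n u(2) uA x unfolding trim_def by blast
      then show False using dj[OF _ X1(1), of U] U u(1) X1(2) by (auto simp: disjnt_def)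
    qed
    then show ?thesis using r by blast
  qed
  have "\<exists>\<pi>. matching same_trim (X1 \<union> \<Union>(?D - {X1})) B \<pi> \<and> fst ` \<pi> \<subseteq> insert X1 (?D - {X1})"
  proof (rule trim_match_family[OF _ _ _ above tX1 B])
    show "finite (?D - {X1})" using fin by simp
    show "pairwise disjnt (?D - {X1})" using dj by (simp add: pairwise_def)
    show "disjnt U X1" if "U \<in> ?D - {X1}" for U using dj[of U X1] that X1(1) by simp
  qed
  moreover have "X1 \<union> \<Union>(?D - {X1}) = A" using un X1(1) by blast
  moreover have "insert X1 (?D - {X1}) = ?D" using X1(1) by blast
  ultimately obtain \<pi> where \<pi>: "matching same_trim A B \<pi>" "fst ` \<pi> \<subseteq> ?D" by auto
  then show "\<exists>\<pi>. matching same_trim A B \<pi> \<and> (\<forall>p\<in>\<pi>. decides C (fst p))"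
    using dec by blast
qed

lemma same_trim_cong:
  assumes "trim q U" "trim q V"
  shows "U \<asymp> V"
proof -
  have "same_trim\<inverse>\<inverse> = same_trim" by (auto simp: same_trim_def fun_eq_iff)
  then have "forth same_trim\<inverse>\<inverse>" using forth_same_trim by simp
  moreover have "A \<in> Co W \<and> B \<in> Co W \<and> (A = {} \<longleftrightarrow> B = {})" if "same_trim A B" for A B
    using that by (auto simp: same_trim_def trim_def)
  moreover have "same_trim U V" using assms by (auto simp: same_trim_def)
  ultimately obtain f where "co_iso U V f"
    using back_and_forth[of same_trim U V] forth_same_trim by metis
  then show ?thesis unfolding cong_def by blast
qed

lemma trim_pseudo_indecomposable:
  assumes U: "trim q U"
  shows "pseudo_indecomposable W U"
  unfolding pseudo_indecomposable_def
proof (intro conjI ballI impI)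
  have UC: "U \<in> Co W" using trim_Co U .
  then show "U \<in> Co W" .
  fix B assume B: "B \<in> Co W" "B \<subseteq> U"
  obtain u where u: "u \<in> U" "label u = q" using U by (auto simp: trim_def)
  have UB: "U - B \<in> Co W" using Co_Diff UC B by blast
  show "principal_ring W B \<simeq> principal_ring W U \<or> principal_ring W (U - B) \<simeq> principal_ring W U"
  proof (cases "u \<in> B")
    case True
    then have "trim q B" using trim_subset[OF U B] u by blast
    then show ?thesis using same_trim_cong U cong_imp_ring_iso by blast
  next
    case False
    then have "trim q (U - B)" using trim_subset[OF U UB] u by blast
    then show ?thesis using same_trim_cong U cong_imp_ring_iso by blast
  qed
qed

theorem rank_partition_imp_primitive: "primitive_space W"
  unfolding primitive_space_def
proof
  fix A assume "A \<in> Co W"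
  then obtain D where "trim_family D A" using trim_family_exists by blast
  then show "\<exists>\<F>. finite \<F> \<and> pairwise disjnt \<F> \<and> \<Union>\<F> = A \<and> (\<forall>B\<in>\<F>. pseudo_indecomposable W B)"
    using trim_pseudo_indecomposable unfolding trim_family_def by blast
qed

end

section \<open>Local types\<close>

context omega_stone
begin

text \<open>Pseudo-indecomposable sets, without the empty set, which the ring-theoretic definition
  admits.\<close>

definition PI :: "'a set \<Rightarrow> bool" where
  "PI A \<longleftrightarrow> A \<in> Co W \<and> A \<noteq> {} \<and> (\<forall>B\<in>Co W. B \<subseteq> A \<longrightarrow> B \<asymp> A \<or> A - B \<asymp> A)"

text \<open>On pseudo-indecomposable sets up to isomorphism this is a partial order. It is read
  downwards: a set that embeds in another one has the larger type, so that types grow, like labels,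
  when a neighbourhood shrinks.\<close>

definition embeds :: "'a set \<Rightarrow> 'a set \<Rightarrow> bool" where
  "embeds A B \<longleftrightarrow> B \<in> Co W \<and> (\<exists>C. C \<subseteq> B \<and> A \<asymp> C)"

text \<open>All types of pseudo-indecomposable sets that lie below the type of some neighbourhood of \<open>x\<close>.
  In a primitive space this is a complete invariant of the orbit of \<open>x\<close>.\<close>

definition types :: "'a \<Rightarrow> 'a set set" where
  "types x = {B. PI B \<and> (\<exists>Z. PI Z \<and> x \<in> Z \<and> embeds Z B)}"

lemma PI_Co: "PI A \<Longrightarrow> A \<in> Co W"
  by (simp add: PI_def)

lemma PI_absorb: "PI A \<Longrightarrow> B \<in> Co W \<Longrightarrow> B \<subseteq> A \<Longrightarrow> \<not> B \<asymp> A \<Longrightarrow> A - B \<asymp> A"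
  by (auto simp: PI_def)

lemma pseudo_indecomposable_imp_PI:
  assumes "pseudo_indecomposable W A" "A \<noteq> {}"
  shows "PI A"
proof -
  have A: "A \<in> Co W" using assms by (simp add: pseudo_indecomposable_def)
  show ?thesis
    unfolding PI_def
  proof (intro conjI ballI impI A assms(2))
    fix B assume B: "B \<in> Co W" "B \<subseteq> A"
    then have "principal_ring W B \<simeq> principal_ring W A \<or> principal_ring W (A - B) \<simeq> principal_ring W A"
      using assms(1) by (simp add: pseudo_indecomposable_def)
    then show "B \<asymp> A \<or> A - B \<asymp> A"
      using ring_iso_imp_cong[OF B(1) A] ring_iso_imp_cong[OF Co_Diff[OF A B(1)] A] by blast
  qed
qed

lemma PI_cong:
  assumes A: "PI A" and AB: "A \<asymp> B"
  shows "PI B"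
  unfolding PI_def
proof (intro conjI ballI impI)
  show "B \<in> Co W" using cong_Co[OF AB] by simp
  show "B \<noteq> {}" using cong_empty[OF AB] A by (simp add: PI_def)
  fix D assume D: "D \<in> Co W" "D \<subseteq> B"
  obtain C where C: "C \<in> Co W" "C \<subseteq> A" "D \<asymp> C" "B - D \<asymp> A - C"
    by (rule cong_split[OF cong_sym[OF AB] D])
  have "C \<asymp> A \<or> A - C \<asymp> A" using A C(1,2) by (simp add: PI_def)
  then show "D \<asymp> B \<or> B - D \<asymp> B" using cong_trans C(3,4) AB by blast
qed

lemma embeds_Co: "embeds A B \<Longrightarrow> A \<in> Co W \<and> B \<in> Co W"
  using cong_Co by (auto simp: embeds_def)

lemma embeds_subset: "A \<in> Co W \<Longrightarrow> B \<in> Co W \<Longrightarrow> A \<subseteq> B \<Longrightarrow> embeds A B"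
  unfolding embeds_def using cong_refl by blast

lemma cong_imp_embeds: "A \<asymp> B \<Longrightarrow> embeds A B"
  unfolding embeds_def using cong_Co by blast

lemma embeds_trans:
  assumes AB: "embeds A B" and BC: "embeds B C"
  shows "embeds A C"
proof -
  obtain A' where A': "A' \<subseteq> B" "A \<asymp> A'" using AB unfolding embeds_def by blast
  obtain B' where B': "B' \<subseteq> C" "B \<asymp> B'" using BC unfolding embeds_def by blast
  obtain D where D: "D \<in> Co W" "D \<subseteq> B'" "A' \<asymp> D" "B - A' \<asymp> B' - D"
    using cong_split[OF B'(2) _ A'(1)] cong_Co[OF A'(2)] by blast
  have "A \<asymp> D" using A'(2) D(3) by (rule cong_trans)
  then show ?thesis using embeds_Co[OF BC] D(2) B'(1) unfolding embeds_def by blast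
qed

text \<open>A Cantor-Bernstein property. If neither copy is everything up to isomorphism, then
  removing the copy of \<open>A\<close> from \<open>B\<close> leaves \<open>B\<close> and removing the copy of \<open>B\<close> from \<open>A\<close> leaves \<open>A\<close>, so both sets
  are isomorphic to a disjoint union of \<open>A\<close> and \<open>B\<close>.\<close>

lemma PI_embeds_antisym:
  assumes A: "PI A" and B: "PI B" and AB: "embeds A B" and BA: "embeds B A"
  shows "A \<asymp> B"
proof -
  obtain C where C: "C \<subseteq> B" "A \<asymp> C" using AB unfolding embeds_def by blast
  obtain D where D: "D \<subseteq> A" "B \<asymp> D" using BA unfolding embeds_def by blast
  have CD: "C \<in> Co W" "D \<in> Co W" using cong_Co C D by blast+
  show ?thesis
  proof (cases "C \<asymp> B \<or> D \<asymp> A")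
    case True
    then show ?thesis using cong_trans[OF C(2)] cong_trans[OF D(2)] cong_sym by blast
  next
    case False
    then have "B - C \<asymp> B" "A - D \<asymp> A"
      using PI_absorb[OF B CD(1) C(1)] PI_absorb[OF A CD(2) D(1)] by auto
    then have "D \<asymp> B - C" "A - D \<asymp> C"
      using cong_trans C(2) D(2) cong_sym by blast+
    then have "D \<union> (A - D) \<asymp> (B - C) \<union> C" by (rule cong_Un) auto
    moreover have "D \<union> (A - D) = A" "(B - C) \<union> C = B" using C(1) D(1) by auto
    ultimately show ?thesis by simp
  qed
qed

lemma types_self: "PI Z \<Longrightarrow> x \<in> Z \<Longrightarrow> Z \<in> types x"
  unfolding types_def using PI_Co embeds_subset by blast

lemma types_PI: "B \<in> types x \<Longrightarrow> PI B"
  by (simp add: types_def)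

lemma types_up: "B \<in> types x \<Longrightarrow> PI C \<Longrightarrow> embeds B C \<Longrightarrow> C \<in> types x"
  unfolding types_def using embeds_trans by blast

lemma types_homeo_subset:
  assumes y: "y \<in> homeo_orbit W x"
  shows "types x \<subseteq> types y"
proof
  fix B assume "B \<in> types x"
  then obtain Z where Z: "PI B" "PI Z" "x \<in> Z" "embeds Z B" by (auto simp: types_def)
  obtain h where h: "homeomorphic_map W W h" "y = h x" using y unfolding homeo_orbit_def by blast
  have "Z \<asymp> h ` Z" using homeomorphic_co_iso[OF h(1) PI_Co[OF Z(2)]] unfolding cong_def by blast
  then have "PI (h ` Z)" "embeds (h ` Z) Z" using PI_cong[OF Z(2)] cong_sym cong_imp_embeds by blast+
  moreover have "y \<in> h ` Z" using h Z by blast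
  ultimately show "B \<in> types y" using Z embeds_trans unfolding types_def by blast
qed

lemma types_orbit:
  assumes x: "x \<in> topspace W" and y: "y \<in> homeo_orbit W x"
  shows "types y = types x"
  using types_homeo_subset[OF y] types_homeo_subset[of x y] homeo_orbit_eqI[OF x y] homeo_orbit_self
  by blast

end

locale primitive_stone = omega_stone +
  assumes primitive: "primitive_space W"
begin

lemma PI_nbhd:
  assumes N: "N \<in> Co W" and x: "x \<in> N"
  obtains Z where "PI Z" "x \<in> Z" "Z \<subseteq> N"
proof -
  obtain \<F> where \<F>: "\<Union>\<F> = N" "\<forall>B\<in>\<F>. pseudo_indecomposable W B"
    using primitive N unfolding primitive_space_def by metis
  then obtain Z where "Z \<in> \<F>" "x \<in> Z" using x by blast
  then show thesis using that[of Z] \<F> pseudo_indecomposable_imp_PI[of Z] by blast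
qed

lemma types_small:
  assumes B: "B \<in> types x" and N: "N \<in> Co W" "x \<in> N"
  obtains Z where "PI Z" "x \<in> Z" "Z \<subseteq> N" "embeds Z B"
proof -
  obtain Z where Z: "PI Z" "x \<in> Z" "embeds Z B" using B by (auto simp: types_def)
  have "Z \<inter> N \<in> Co W" "x \<in> Z \<inter> N" using Co_Int PI_Co Z N by auto
  then obtain Y where Y: "PI Y" "x \<in> Y" "Y \<subseteq> Z \<inter> N" by (rule PI_nbhd)
  then have "embeds Y Z" using embeds_subset PI_Co Z by blast
  then show thesis using that Y embeds_trans Z(3) by blast
qed

text \<open>A type that occurs in \<open>types x\<close> occurs in \<open>Y\<close> as a neighbourhood of \<open>x\<close> itself. A copy \<open>A'\<close> of \<open>A\<close>
  inside \<open>Y\<close> may miss \<open>x\<close>, but a small neighbourhood \<open>Z\<close> of \<open>x\<close> is either a copy of \<open>A\<close> or of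
  strictly larger type; in the latter case it is absorbed, and \<open>A' \<union> Z\<close> is still a copy of \<open>A\<close>.\<close>

lemma types_realised_at:
  assumes Y: "PI Y" "x \<in> Y" and A: "A \<in> types x" "embeds A Y"
  obtains Z where "Z \<subseteq> Y" "x \<in> Z" "Z \<asymp> A"
proof -
  obtain Z where Z: "PI Z" "x \<in> Z" "Z \<subseteq> Y" "embeds Z A"
    by (rule types_small[OF A(1) PI_Co[OF Y(1)] Y(2)])
  obtain A' where A': "A' \<subseteq> Y" "A \<asymp> A'" using A(2) unfolding embeds_def by blast
  have PA: "PI A" "PI A'" using types_PI[OF A(1)] PI_cong A'(2) by blast+
  show thesis
  proof (cases "Z \<asymp> A")
    case True then show thesis using that Z by blast
  next
    case False
    have ZA': "embeds Z A'" using embeds_trans Z(4) cong_imp_embeds A'(2) by blast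
    have Co: "A' \<inter> Z \<in> Co W" using Co_Int PI_Co PA Z by blast
    have "\<not> A' \<inter> Z \<asymp> A'"
    proof
      assume "A' \<inter> Z \<asymp> A'"
      then have "embeds A' Z"
        using embeds_subset[OF Co PI_Co[OF Z(1)]] cong_imp_embeds cong_sym embeds_trans by blast
      then have "Z \<asymp> A'" using PI_embeds_antisym Z(1) PA(2) ZA' by blast
      then show False using False A'(2) cong_sym cong_trans by blast
    qed
    then have 1: "A' - Z \<asymp> A'" using PI_absorb[OF PA(2) Co] by (auto simp: Diff_Int)
    obtain Z' where Z': "Z' \<subseteq> A" "Z \<asymp> Z'" using Z(4) unfolding embeds_def by blast
    have Z'C: "Z' \<in> Co W" using cong_Co[OF Z'(2)] by simp
    have "\<not> Z' \<asymp> A" using False cong_trans[OF Z'(2)] by blast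
    then have 2: "A - Z' \<asymp> A" using PI_absorb[OF PA(1) Z'C Z'(1)] by simp
    have "A' - Z \<asymp> A - Z'" using 1 2 A'(2) cong_sym cong_trans by blast
    then have "(A' - Z) \<union> Z \<asymp> (A - Z') \<union> Z'" using Z'(2) by (rule cong_Un) auto
    moreover have "(A - Z') \<union> Z' = A" using Z'(1) by blast
    ultimately show thesis using that[of "(A' - Z) \<union> Z"] A'(1) Z by auto
  qed
qed

text \<open>The forth step around the marked points. If \<open>w\<close> has a neighbourhood \<open>Z\<close> of strictly larger type
  than \<open>X\<close>, then \<open>x\<close> has one of the same type, and both remainders are isomorphic to \<open>X\<close> by
  pseudo-indecomposability. Otherwise all small neighbourhoods of \<open>w\<close>, hence also those of \<open>x\<close>, are
  isomorphic to \<open>X\<close>. Then a splitting of \<open>X\<close> at \<open>w\<close> is copied to \<open>Y\<close>, and if \<open>x\<close> ends up in the wrong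
  part, a neighbourhood of \<open>x\<close> in that part changes places with the copy of \<open>Z\<close>.\<close>

lemma pointed_split:
  assumes eq: "types w = types x" and X: "PI X" and Y: "PI Y" and XY: "X \<asymp> Y"
    and w: "w \<in> X" "w \<in> N" and x: "x \<in> Y" and N: "N \<in> Co W"
  obtains Z Y' where "PI Z" "w \<in> Z" "Z \<subseteq> X \<inter> N" "x \<in> Y'" "Y' \<subseteq> Y" "Z \<asymp> Y'" "X - Z \<asymp> Y - Y'"
proof -
  have XN: "X \<inter> N \<in> Co W" "w \<in> X \<inter> N" using Co_Int PI_Co X N w by auto
  show thesis
  proof (cases "\<exists>Z. PI Z \<and> w \<in> Z \<and> Z \<subseteq> X \<inter> N \<and> \<not> Z \<asymp> X")
    case True
    then obtain Z where Z: "PI Z" "w \<in> Z" "Z \<subseteq> X \<inter> N" "\<not> Z \<asymp> X" by blast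
    have 1: "X - Z \<asymp> X" using PI_absorb[OF X PI_Co[OF Z(1)]] Z by blast
    have "embeds Z X" using embeds_subset PI_Co Z X by blast
    then have "embeds Z Y" using embeds_trans cong_imp_embeds[OF XY] by blast
    moreover have "Z \<in> types x" using types_self[OF Z(1,2)] eq by simp
    ultimately obtain Y' where Y': "Y' \<subseteq> Y" "x \<in> Y'" "Y' \<asymp> Z"
      using types_realised_at[OF Y x] by metis
    have "\<not> Y' \<asymp> Y" using Z(4) Y'(3) XY cong_sym cong_trans by blast
    then have "Y - Y' \<asymp> Y" using PI_absorb[OF Y _ Y'(1)] cong_Co[OF Y'(3)] by blast
    then have "X - Z \<asymp> Y - Y'" using 1 XY cong_sym cong_trans by blast
    then show thesis using that Z Y' cong_sym by blast
  next
    case False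
    obtain Z where Z: "PI Z" "w \<in> Z" "Z \<subseteq> X \<inter> N" by (rule PI_nbhd[OF XN])
    then have ZX: "Z \<asymp> X" using False by blast
    obtain Y1 where Y1: "Y1 \<in> Co W" "Y1 \<subseteq> Y" "Z \<asymp> Y1" "X - Z \<asymp> Y - Y1"
      using cong_split[OF XY PI_Co[OF Z(1)]] Z(3) by blast
    show thesis
    proof (cases "x \<in> Y1")
      case True then show thesis using that Z Y1 by blast
    next
      case x1: False
      \<comment> \<open>the copy \<open>?E\<close> of \<open>X - Z\<close> contains \<open>x\<close>; replace \<open>V\<close> by \<open>Y1\<close> in it\<close>
      let ?E = "Y - Y1"
      have "?E \<in> Co W" "x \<in> ?E" using Co_Diff PI_Co[OF Y] Y1(1) x x1 by auto
      then obtain V where V: "PI V" "x \<in> V" "V \<subseteq> ?E" by (rule PI_nbhd)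
      have "V \<in> types w" using types_self[OF V(1,2)] eq by simp
      then obtain Z' where Z': "PI Z'" "w \<in> Z'" "Z' \<subseteq> X \<inter> N" "embeds Z' V"
        by (rule types_small[OF _ XN])
      then have "embeds X V" using False cong_imp_embeds cong_sym embeds_trans by blast
      moreover have "embeds V X"
        using embeds_subset[OF PI_Co[OF V(1)] PI_Co[OF Y]] V(3) cong_imp_embeds cong_sym[OF XY] embeds_trans
        by blast
      ultimately have VX: "V \<asymp> X" using PI_embeds_antisym V(1) X by blast
      have ZV: "Z \<asymp> V" using ZX VX cong_sym cong_trans by blast
      have "V \<asymp> Y1" using ZV Y1(3) cong_sym cong_trans by blast
      moreover have "?E - V \<asymp> ?E - V" using Co_Diff \<open>?E \<in> Co W\<close> PI_Co[OF V(1)] by simp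
      ultimately have "V \<union> (?E - V) \<asymp> Y1 \<union> (?E - V)" by (rule cong_Un) auto
      moreover have "V \<union> (?E - V) = ?E" "Y1 \<union> (?E - V) = Y - V" using V(3) Y1(2) by auto
      ultimately have "X - Z \<asymp> Y - V" using Y1(4) cong_trans by simp
      then show thesis using that[of Z V] Z V ZV by blast
    qed
  qed
qed

text \<open>Isomorphism that respects marked points \<open>w\<close> and \<open>x\<close>. Pieces containing them are required to be
  pseudo-indecomposable, so that the splitting above applies to them again.\<close>

definition pointed_cong :: "'a \<Rightarrow> 'a \<Rightarrow> 'a set \<Rightarrow> 'a set \<Rightarrow> bool" where
  "pointed_cong w x U V \<longleftrightarrow> U \<asymp> V \<and> (w \<notin> U \<and> x \<notin> V \<or> w \<in> U \<and> x \<in> V \<and> PI U \<and> PI V)"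

lemma match_cong:
  assumes UV: "U \<asymp> V" and C: "C \<in> Co W" and p: "w \<notin> U" "x \<notin> V"
  obtains \<pi> where "matching (pointed_cong w x) U V \<pi>" "\<forall>p\<in>\<pi>. decides C (fst p)"
proof -
  have "U \<inter> C \<in> Co W" "U \<inter> C \<subseteq> U" using Co_Int cong_Co[OF UV] C by auto
  then obtain D where D: "D \<in> Co W" "D \<subseteq> V" "U \<inter> C \<asymp> D" "U - U \<inter> C \<asymp> V - D"
    by (rule cong_split[OF UV])
  have "matching (pointed_cong w x) (U \<inter> C \<union> (U - U \<inter> C)) (D \<union> (V - D))
      ({(U \<inter> C, D)} \<union> {(U - U \<inter> C, V - D)})"
    by (intro matching_Un matching_singleton) (use D p in \<open>auto simp: pointed_cong_def\<close>)
  moreover have "U \<inter> C \<union> (U - U \<inter> C) = U" "D \<union> (V - D) = V" using D(2) by auto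
  ultimately have "matching (pointed_cong w x) U V ({(U \<inter> C, D)} \<union> {(U - U \<inter> C, V - D)})" by simp
  then show thesis by (rule that) (auto simp: decides_def)
qed

lemma forth_pointed_cong:
  assumes eq: "types w = types x"
  shows "forth (pointed_cong w x)"
  unfolding forth_def
proof (intro allI impI)
  fix A B C assume AB: "pointed_cong w x A B" and C: "C \<in> Co W"
  show "\<exists>\<pi>. matching (pointed_cong w x) A B \<pi> \<and> (\<forall>p\<in>\<pi>. decides C (fst p))"
  proof (cases "w \<in> A")
    case False
    then have "A \<asymp> B" "w \<notin> A" "x \<notin> B" using AB by (auto simp: pointed_cong_def)
    then show ?thesis using match_cong[OF _ C] by metis
  next
    case True
    then have AB': "A \<asymp> B" "x \<in> B" "PI A" "PI B" using AB by (auto simp: pointed_cong_def)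
    define N where "N = (if w \<in> C then C else A - C)"
    have N: "N \<in> Co W" "w \<in> N" using True C Co_Diff[OF PI_Co[OF AB'(3)] C] by (auto simp: N_def)
    obtain Z Y where Z: "PI Z" "w \<in> Z" "Z \<subseteq> A \<inter> N" "x \<in> Y" "Y \<subseteq> B" "Z \<asymp> Y" "A - Z \<asymp> B - Y"
      by (rule pointed_split[OF eq AB'(3,4,1) True N(2) AB'(2) N(1)])
    have Zd: "decides C Z" using Z(3) by (auto simp: decides_def N_def split: if_splits)
    obtain \<pi> where \<pi>: "matching (pointed_cong w x) (A - Z) (B - Y) \<pi>" "\<forall>p\<in>\<pi>. decides C (fst p)"
      using match_cong[OF Z(7) C, of w x] Z(2,4) by blast
    have "pointed_cong w x Z Y"
      using Z PI_cong by (auto simp: pointed_cong_def)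
    then have "matching (pointed_cong w x) (Z \<union> (A - Z)) (Y \<union> (B - Y)) ({(Z, Y)} \<union> \<pi>)"
      by (intro matching_Un matching_singleton \<pi>) auto
    moreover have "Z \<union> (A - Z) = A" "Y \<union> (B - Y) = B" using Z(3,5) by auto
    ultimately have "matching (pointed_cong w x) A B ({(Z, Y)} \<union> \<pi>)" by simp
    then show ?thesis using Zd \<pi>(2) by (intro exI[of _ "{(Z, Y)} \<union> \<pi>"]) auto
  qed
qed

lemma types_eq_imp_orbit:
  assumes eq: "types w = types x" and w: "w \<in> topspace W" and x: "x \<in> topspace W"
  shows "x \<in> homeo_orbit W w"
proof -
  obtain N where N: "N \<in> Co W" "x \<in> N" by (rule Co_nbhd[OF x])
  obtain Y where Y: "PI Y" "x \<in> Y" "Y \<subseteq> N" by (rule PI_nbhd[OF N])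
  have "Y \<in> types w" using types_self[OF Y(1,2)] eq by simp
  then obtain A where A: "PI A" "w \<in> A" "embeds A Y" by (auto simp: types_def)
  have "A \<in> types x" using types_self[OF A(1,2)] eq by simp
  then obtain B where B: "B \<subseteq> Y" "x \<in> B" "B \<asymp> A"
    by (rule types_realised_at[OF Y(1,2) _ A(3)])
  have AB: "pointed_cong w x A B"
    using A B PI_cong cong_sym unfolding pointed_cong_def by blast
  have "(pointed_cong w x)\<inverse>\<inverse> = pointed_cong x w"
    using cong_sym by (auto simp: pointed_cong_def fun_eq_iff)
  then have fo: "forth (pointed_cong w x)" "forth (pointed_cong w x)\<inverse>\<inverse>"
    using forth_pointed_cong eq by simp_all
  have R: "U \<in> Co W \<and> V \<in> Co W \<and> (U = {} \<longleftrightarrow> V = {})" if "pointed_cong w x U V" for U V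
    using that cong_Co cong_empty unfolding pointed_cong_def by blast
  obtain f where f: "co_iso A B f" and loc: "\<And>a N. a \<in> A \<Longrightarrow> N \<in> Co W \<Longrightarrow> f a \<in> N \<Longrightarrow>
      \<exists>U V. pointed_cong w x U V \<and> a \<in> U \<and> V \<subseteq> N"
    using back_and_forth[OF R fo AB] by metis
  \<comment> \<open>otherwise some related pair \<open>U\<close>, \<open>V\<close> would have \<open>w \<in> U\<close> but \<open>x \<notin> V\<close>\<close>
  have "f w = x"
  proof (rule ccontr)
    assume ne: "f w \<noteq> x"
    have "f w \<in> B" using f A(2) by (auto simp: co_iso_def bij_betw_def)
    then have "f w \<in> topspace W" using cong_Co[OF B(3)] Co_subset_topspace by blast
    then obtain C D where CD: "C \<in> Co W" "D \<in> Co W" "f w \<in> C" "x \<in> D" "C \<inter> D = {}"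
      by (rule Co_separate[OF _ x ne])
    obtain U V where "pointed_cong w x U V" "w \<in> U" "V \<subseteq> C" using loc[OF A(2) CD(1,3)] by blast
    then show False using CD(4,5) by (auto simp: pointed_cong_def)
  qed
  then show ?thesis using co_iso_orbit[OF f A(2)] by simp
qed

text \<open>Every increasing sequence of types is the sequence of types of a shrinking neighbourhood
  base of a suitable point. By pseudo-indecomposability a copy of \<open>A n\<close> can be chosen inside a given
  compact open set or inside its complement, so a descending sequence of copies can be made to
  converge to a point.\<close>

lemma types_limit_realised:
  fixes A :: "nat \<Rightarrow> 'a set"
  assumes A: "\<And>n. PI (A n)" "\<And>n. embeds (A (Suc n)) (A n)"
  obtains u where "u \<in> A 0" "types u = {B. PI B \<and> (\<exists>n. embeds (A n) B)}"
proof -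
  obtain e :: "nat \<Rightarrow> 'a set" where e: "range e = Co W" by (rule Co_enum)
  have eC: "e n \<in> Co W" for n using e by blast
  have "\<exists>B. \<forall>n. (B n \<asymp> A n \<and> B n \<subseteq> A 0) \<and> (B (Suc n) \<subseteq> B n \<and> decides (e n) (B (Suc n)))"
  proof (rule dependent_nat_choice)
    show "\<exists>B. B \<asymp> A 0 \<and> B \<subseteq> A 0" using cong_refl PI_Co[OF A(1)[of 0]] by blast
    fix B n assume B: "B \<asymp> A n \<and> B \<subseteq> A 0"
    have "embeds (A (Suc n)) B" using A(2)[of n] B cong_sym cong_imp_embeds embeds_trans by blast
    then obtain C where C: "C \<subseteq> B" "A (Suc n) \<asymp> C" unfolding embeds_def by blast
    have PC: "PI C" using PI_cong A(1) C(2) by blast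
    have "C \<inter> e n \<in> Co W" using Co_Int PI_Co PC eC by blast
    then have "C \<inter> e n \<asymp> C \<or> C - C \<inter> e n \<asymp> C" using PC by (simp add: PI_def)
    then obtain D where D: "D \<subseteq> C" "D \<asymp> C" "decides (e n) D"
    proof
      assume "C \<inter> e n \<asymp> C" then show thesis using that[of "C \<inter> e n"] by (auto simp: decides_def)
    next
      assume "C - C \<inter> e n \<asymp> C"
      then show thesis using that[of "C - C \<inter> e n"] by (auto simp: decides_def)
    qed
    have "D \<asymp> A (Suc n)" using D(2) C(2) cong_sym cong_trans by blast
    then show "\<exists>B'. (B' \<asymp> A (Suc n) \<and> B' \<subseteq> A 0) \<and> (B' \<subseteq> B \<and> decides (e n) B')"
      using D C B by blast
  qed
  then obtain B where B: "\<And>n. B n \<asymp> A n" "\<And>n. B n \<subseteq> A 0" "\<And>n. B (Suc n) \<subseteq> B n"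
    "\<And>n. decides (e n) (B (Suc n))" by blast
  have PB: "PI (B n)" for n using PI_cong[OF A(1) cong_sym[OF B(1)]] .
  have "(\<Inter>n. B n) \<noteq> {}"
    by (rule Co_nest) (use PB B(3) in \<open>auto simp: PI_def\<close>)
  then obtain u where u: "\<And>n. u \<in> B n" by blast
  have "types u = {C. PI C \<and> (\<exists>n. embeds (A n) C)}"
  proof (intro equalityI subsetI)
    fix C assume "C \<in> types u"
    then obtain Z where Z: "PI C" "PI Z" "u \<in> Z" "embeds Z C" by (auto simp: types_def)
    have "Z \<in> range e" using PI_Co[OF Z(2)] e by simp
    then obtain n where n: "Z = e n" by (rule rangeE)
    have "B (Suc n) \<subseteq> Z" using B(4)[of n] u[of "Suc n"] Z(3) n by (auto simp: decides_def)
    then have "embeds (B (Suc n)) Z" using embeds_subset PI_Co PB Z(2) by blast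
    then have "embeds (A (Suc n)) C"
      using cong_imp_embeds[OF cong_sym[OF B(1)]] embeds_trans Z(4) by blast
    then show "C \<in> {C. PI C \<and> (\<exists>n. embeds (A n) C)}" using Z(1) by blast
  next
    fix C assume "C \<in> {C. PI C \<and> (\<exists>n. embeds (A n) C)}"
    then obtain n where n: "PI C" "embeds (A n) C" by blast
    have "embeds (B n) C" using embeds_trans[OF cong_imp_embeds[OF B(1)] n(2)] .
    then show "C \<in> types u" using types_up[OF types_self[OF PB u] n(1)] by blast
  qed
  moreover have "u \<in> A 0" using u B(2) by blast
  ultimately show thesis using that by blast
qed

end

section \<open>The orbit diagram of a primitive space\<close>

context omega_stone
begin

lemma derivedD:
  "y \<in> W derived_set_of S \<Longrightarrow> openin W T \<Longrightarrow> y \<in> T \<Longrightarrow> \<exists>z. z \<noteq> y \<and> z \<in> S \<and> z \<in> T"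
  by (auto simp: derived_set_of_def)

lemma derived_imp_sequence:
  assumes y: "y \<in> W derived_set_of S"
  obtains ys :: "nat \<Rightarrow> 'a" where "inj ys" "range ys \<subseteq> S" "limitin W ys y sequentially"
proof -
  have yt: "y \<in> topspace W" and lim: "\<And>T. y \<in> T \<Longrightarrow> openin W T \<Longrightarrow> \<exists>z. z \<noteq> y \<and> z \<in> S \<and> z \<in> T"
    using y by (auto simp: derived_set_of_def)
  obtain N where N: "\<And>n. N n \<in> Co W" "\<And>n. y \<in> N n" "\<And>n. N (Suc n) \<subseteq> N n"
    "\<And>U. openin W U \<Longrightarrow> y \<in> U \<Longrightarrow> \<exists>n. N n \<subseteq> U"
    using Co_nbhd_seq[OF yt] by metis
  have step: "\<exists>z M'. M' \<in> Co W \<and> y \<in> M' \<and> M' \<subseteq> M \<and> z \<in> M \<and> z \<in> S \<and> z \<notin> M' \<and> z \<in> N n"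
    if M: "M \<in> Co W" "y \<in> M" for M n
  proof -
    have "openin W (M \<inter> N n)" using Co_openin[OF Co_Int[OF M(1) N(1)]] .
    then obtain z where z: "z \<noteq> y" "z \<in> S" "z \<in> M \<inter> N n" using lim[of "M \<inter> N n"] M(2) N(2) by blast
    have "z \<in> topspace W" using z(3) Co_subset_topspace[OF M(1)] by blast
    then obtain C D where CD: "C \<in> Co W" "D \<in> Co W" "z \<in> C" "y \<in> D" "C \<inter> D = {}"
      using Co_separate[OF _ yt z(1)] by metis
    have "M \<inter> D \<in> Co W" using Co_Int M CD by blast
    moreover have "z \<notin> M \<inter> D" using CD by blast
    ultimately show ?thesis using z CD(4) M(2) by blast
  qed
  \<comment> \<open>the second components are neighbourhoods of \<open>y\<close> that exclude the points chosen so far\<close>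
  have "\<exists>f :: nat \<Rightarrow> 'a \<times> 'a set. \<forall>n. (snd (f n) \<in> Co W \<and> y \<in> snd (f n)) \<and>
      (snd (f (Suc n)) \<subseteq> snd (f n) \<and> fst (f (Suc n)) \<in> snd (f n) \<and> fst (f (Suc n)) \<in> S \<and>
       fst (f (Suc n)) \<notin> snd (f (Suc n)) \<and> fst (f (Suc n)) \<in> N n)"
  proof (rule dependent_nat_choice)
    show "\<exists>x :: 'a \<times> 'a set. snd x \<in> Co W \<and> y \<in> snd x" by (rule exI[of _ "(y, N 0)"]) (simp add: N)
    fix p :: "'a \<times> 'a set" and n assume "snd p \<in> Co W \<and> y \<in> snd p"
    then obtain z M' where "M' \<in> Co W \<and> y \<in> M' \<and> M' \<subseteq> snd p \<and> z \<in> snd p \<and> z \<in> S \<and> z \<notin> M' \<and> z \<in> N n"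
      using step[of "snd p" n] by blast
    then show "\<exists>q. (snd q \<in> Co W \<and> y \<in> snd q) \<and> (snd q \<subseteq> snd p \<and> fst q \<in> snd p \<and> fst q \<in> S \<and>
       fst q \<notin> snd q \<and> fst q \<in> N n)"
      by (intro exI[where x = "(z, M')"]) simp
  qed
  then obtain f :: "nat \<Rightarrow> 'a \<times> 'a set" where f: "\<And>n. snd (f (Suc n)) \<subseteq> snd (f n)"
    "\<And>n. fst (f (Suc n)) \<in> snd (f n)" "\<And>n. fst (f (Suc n)) \<in> S"
    "\<And>n. fst (f (Suc n)) \<notin> snd (f (Suc n))" "\<And>n. fst (f (Suc n)) \<in> N n" by blast
  define ys where "ys n = fst (f (Suc n))" for n
  have dec: "snd (f n) \<subseteq> snd (f m)" if "m \<le> n" for m n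
    using f(1) that by (rule lift_Suc_antimono_le)
  have ne: "ys i \<noteq> ys j" if "i < j" for i j
  proof -
    have "ys j \<in> snd (f (Suc i))" using f(2)[of j] dec[of "Suc i" j] that by (auto simp: ys_def)
    then show ?thesis using f(4)[of i] by (auto simp: ys_def)
  qed
  have "inj ys"
  proof (rule injI)
    fix i j assume "ys i = ys j"
    then show "i = j" using ne[of i j] ne[of j i] by (cases i j rule: linorder_cases) auto
  qed
  moreover have "range ys \<subseteq> S" using f(3) by (auto simp: ys_def)
  moreover have "limitin W ys y sequentially"
    by (rule limitin_nbhd_seq[OF yt N(3,4)]) (simp_all add: ys_def f(5))
  ultimately show thesis by (rule that)
qed

lemma sequence_imp_derived:
  fixes ys :: "nat \<Rightarrow> 'a"
  assumes "inj ys" "range ys \<subseteq> S" "limitin W ys y sequentially"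
  shows "y \<in> W derived_set_of S"
proof -
  have "\<exists>z. z \<noteq> y \<and> z \<in> S \<and> z \<in> T" if T: "y \<in> T" "openin W T" for T
  proof -
    obtain n where n: "\<And>m. m \<ge> n \<Longrightarrow> ys m \<in> T"
      using assms(3) T unfolding limitin_sequentially by blast
    have "ys n \<noteq> ys (Suc n)" using assms(1) by (simp add: inj_eq)
    then have "ys n \<noteq> y \<or> ys (Suc n) \<noteq> y" by auto
    then show ?thesis using n[of n] n[of "Suc n"] assms(2) by auto
  qed
  then show ?thesis using limitin_topspace[OF assms(3)] by (auto simp: derived_set_of_def)
qed

lemma homeo_derived_orbit:
  assumes x: "x \<in> topspace W" and y: "y \<in> W derived_set_of (homeo_orbit W x)" and h: "homeomorphic_map W W h"
  shows "h y \<in> W derived_set_of (homeo_orbit W x)"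
proof -
  have yt: "y \<in> topspace W" using y by (simp add: derived_set_of_def)
  have cont: "continuous_map W W h" and inj: "inj_on h (topspace W)"
    using homeomorphic_imp_continuous_map[OF h] homeomorphic_imp_injective_map[OF h] .
  have im: "h z \<in> topspace W" if "z \<in> topspace W" for z
    using homeomorphic_imp_surjective_map[OF h] that by blast
  have "\<exists>z. z \<noteq> h y \<and> z \<in> homeo_orbit W x \<and> z \<in> T" if T: "h y \<in> T" "openin W T" for T
  proof -
    have "openin W {z \<in> topspace W. h z \<in> T}"
      using openin_continuous_map_preimage[OF cont T(2)] .
    moreover have "y \<in> {z \<in> topspace W. h z \<in> T}" using yt T(1) by simp
    ultimately obtain z where z: "z \<noteq> y" "z \<in> homeo_orbit W x" "z \<in> topspace W" "h z \<in> T"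
      using derivedD[OF y] by blast
    have "h z \<in> homeo_orbit W z" using h unfolding homeo_orbit_def by blast
    then have "h z \<in> homeo_orbit W x" using homeo_orbit_eqI[OF x z(2)] by simp
    moreover have "h z \<noteq> h y" using inj z yt by (auto simp: inj_on_def)
    ultimately show ?thesis using z(4) by blast
  qed
  then show ?thesis using im[OF yt] by (auto simp: derived_set_of_def)
qed

lemma orbit_less_iff_derived:
  assumes w: "w \<in> topspace W" and x: "x \<in> topspace W"
  shows "orbit_less W (homeo_orbit W w) (homeo_orbit W x) \<longleftrightarrow> w \<in> W derived_set_of (homeo_orbit W x)"
proof
  assume "orbit_less W (homeo_orbit W w) (homeo_orbit W x)"
  then obtain y and ys :: "nat \<Rightarrow> 'a" where y: "y \<in> homeo_orbit W w" "inj ys" "range ys \<subseteq> homeo_orbit W x"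
    "limitin W ys y sequentially" unfolding orbit_less_def by blast
  have "w \<in> homeo_orbit W y" using homeo_orbit_eqI[OF w y(1)] homeo_orbit_self by blast
  then obtain h where "homeomorphic_map W W h" "w = h y" unfolding homeo_orbit_def by blast
  then show "w \<in> W derived_set_of (homeo_orbit W x)"
    using homeo_derived_orbit[OF x sequence_imp_derived[OF y(2-4)]] by simp
next
  assume "w \<in> W derived_set_of (homeo_orbit W x)"
  then obtain ys :: "nat \<Rightarrow> 'a" where "inj ys" "range ys \<subseteq> homeo_orbit W x" "limitin W ys w sequentially"
    by (rule derived_imp_sequence)
  then show "orbit_less W (homeo_orbit W w) (homeo_orbit W x)"
    using homeo_orbit_self unfolding orbit_less_def by blast
qed

lemma homeo_orbit_subset: "x \<in> topspace W \<Longrightarrow> homeo_orbit W x \<subseteq> topspace W"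
  using homeomorphic_imp_surjective_map unfolding homeo_orbit_def by blast

end

context primitive_stone
begin

abbreviation orbit :: "'a \<Rightarrow> 'a set" where
  "orbit \<equiv> homeo_orbit W"

abbreviation orbit_le :: "'a set \<Rightarrow> 'a set \<Rightarrow> bool" (infix \<open>\<sqsubseteq>\<close> 50) where
  "U \<sqsubseteq> V \<equiv> po_le (orbit_less W) U V"

lemma orbit_eq_iff:
  assumes "w \<in> topspace W" "x \<in> topspace W"
  shows "orbit w = orbit x \<longleftrightarrow> types w = types x"
  using types_eq_imp_orbit[OF _ assms] homeo_orbit_eqI[OF assms(1)] types_orbit[OF assms(1)] homeo_orbit_self
  by metis

text \<open>The order of the orbit diagram is inclusion of local types. For the converse direction, a
  neighbourhood of \<open>w\<close> contains a copy of a neighbourhood of \<open>x\<close>, and the image of \<open>x\<close> there lies in the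
  orbit of \<open>x\<close>.\<close>

lemma orbit_le_iff:
  assumes w: "w \<in> topspace W" and x: "x \<in> topspace W"
  shows "orbit w \<sqsubseteq> orbit x \<longleftrightarrow> types w \<subseteq> types x"
proof
  assume "orbit w \<sqsubseteq> orbit x"
  then consider "orbit w = orbit x" | "w \<in> W derived_set_of (orbit x)"
    using orbit_less_iff_derived[OF w x] by (auto simp: po_le_def)
  then show "types w \<subseteq> types x"
  proof cases
    case 1 then show ?thesis using orbit_eq_iff[OF w x] by simp
  next
    case 2
    show ?thesis
    proof
      fix B assume "B \<in> types w"
      then obtain Z where Z: "PI B" "PI Z" "w \<in> Z" "embeds Z B" by (auto simp: types_def)
      obtain y where y: "y \<in> orbit x" "y \<in> Z"
        using derivedD[OF 2 Co_openin[OF PI_Co[OF Z(2)]] Z(3)] by blast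
      have "B \<in> types y" using types_up[OF types_self[OF Z(2) y(2)] Z(1,4)] .
      then show "B \<in> types x" using types_orbit[OF x y(1)] by simp
    qed
  qed
next
  assume sub: "types w \<subseteq> types x"
  show "orbit w \<sqsubseteq> orbit x"
  proof (cases "orbit w = orbit x")
    case True then show ?thesis by (simp add: po_le_def)
  next
    case False
    have "\<exists>y. y \<noteq> w \<and> y \<in> orbit x \<and> y \<in> T" if T: "w \<in> T" "openin W T" for T
    proof -
      obtain C where C: "C \<in> Co W" "w \<in> C" "C \<subseteq> T" by (rule Co_base[OF T(2,1)])
      obtain Z where Z: "PI Z" "w \<in> Z" "Z \<subseteq> C" by (rule PI_nbhd[OF C(1,2)])
      have "Z \<in> types x" using types_self[OF Z(1,2)] sub by blast
      then obtain Y where Y: "x \<in> Y" "embeds Y Z" by (auto simp: types_def)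
      then obtain D f where D: "D \<subseteq> Z" "co_iso Y D f" unfolding embeds_def cong_def by blast
      have fx: "f x \<in> D" using D(2) Y(1) by (auto simp: co_iso_def bij_betw_def)
      have fo: "f x \<in> orbit x" using co_iso_orbit[OF D(2) Y(1)] .
      then have "f x \<noteq> w" using False homeo_orbit_eqI[OF x] by blast
      then show ?thesis using fx fo D(1) Z(3) C(3) by blast
    qed
    then have "w \<in> W derived_set_of (orbit x)" using w by (auto simp: derived_set_of_def)
    then show ?thesis using orbit_less_iff_derived[OF w x] by (simp add: po_le_def)
  qed
qed

lemma orbit_lneq_iff:
  assumes w: "w \<in> topspace W" and x: "x \<in> topspace W"
  shows "po_lneq (orbit_less W) (orbit w) (orbit x) \<longleftrightarrow> types w \<subset> types x"
  using orbit_le_iff[OF w x] orbit_eq_iff[OF w x] by (auto simp: po_lneq_def)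

lemma orbit_po_system: "po_system (orbit_diagram W) (orbit_less W)"
  unfolding po_system_def
proof
  show "antisymp_on (orbit_diagram W) (orbit_less W)"
  proof (rule antisymp_onI)
    fix U V assume "U \<in> orbit_diagram W" "V \<in> orbit_diagram W" "orbit_less W U V" "orbit_less W V U"
    then obtain u v where uv: "u \<in> topspace W" "v \<in> topspace W" "U = orbit u" "V = orbit v"
      "orbit u \<sqsubseteq> orbit v" "orbit v \<sqsubseteq> orbit u" by (auto simp: orbit_diagram_def po_le_def)
    then have "types u = types v" using orbit_le_iff by blast
    then show "U = V" using orbit_eq_iff uv by simp
  qed
  show "transp_on (orbit_diagram W) (orbit_less W)"
  proof (rule transp_onI)
    fix U V X assume "U \<in> orbit_diagram W" "V \<in> orbit_diagram W" "X \<in> orbit_diagram W"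
      and less: "orbit_less W U V" "orbit_less W V X"
    then obtain u v x where t: "u \<in> topspace W" "v \<in> topspace W" "x \<in> topspace W"
      and o: "U = orbit u" "V = orbit v" "X = orbit x" by (auto simp: orbit_diagram_def)
    have u: "u \<in> W derived_set_of (orbit v)" and v: "v \<in> W derived_set_of (orbit x)"
      using less orbit_less_iff_derived t o by auto
    have "\<exists>y. y \<noteq> u \<and> y \<in> orbit x \<and> y \<in> T" if T: "u \<in> T" "openin W T" for T
    proof -
      obtain z where z: "z \<noteq> u" "z \<in> orbit v" "z \<in> T" using derivedD[OF u T(2,1)] by blast
      have zt: "z \<in> topspace W" using z(2) homeo_orbit_subset[OF t(2)] by blast
      obtain h where "homeomorphic_map W W h" "z = h v" using z(2) unfolding homeo_orbit_def by blast
      then have zd: "z \<in> W derived_set_of (orbit x)" using homeo_derived_orbit[OF t(3) v] by blast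
      obtain C D where CD: "C \<in> Co W" "D \<in> Co W" "z \<in> C" "u \<in> D" "C \<inter> D = {}"
        by (rule Co_separate[OF zt t(1) z(1)])
      have "openin W (T \<inter> C)" "z \<in> T \<inter> C" using T CD z by (auto intro: openin_Int Co_openin)
      then obtain y where y: "y \<in> orbit x" "y \<in> T \<inter> C" using derivedD[OF zd, of "T \<inter> C"] by auto
      then have "y \<noteq> u" using CD(4,5) by auto
      then show ?thesis using y by auto
    qed
    then have "u \<in> W derived_set_of (orbit x)" using t(1) by (auto simp: derived_set_of_def)
    then show "orbit_less W U X" using orbit_less_iff_derived t o by blast
  qed
qed

lemma orbit_disjoint: "disjoint_family_on (\<lambda>U. U) (orbit_diagram W)"
  unfolding disjoint_family_on_def
proof (intro ballI impI)
  fix U V assume "U \<in> orbit_diagram W" "V \<in> orbit_diagram W" and ne: "U \<noteq> V"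
  then obtain u v where t: "u \<in> topspace W" "v \<in> topspace W" "U = orbit u" "V = orbit v"
    by (auto simp: orbit_diagram_def)
  then show "U \<inter> V = {}"
    using homeo_orbit_eqI[OF t(1)] homeo_orbit_eqI[OF t(2)] ne by blast
qed

lemma orbit_complete_partition:
  "complete_partition W (orbit_diagram W) (orbit_less W) (\<lambda>U. U)"
  unfolding complete_partition_def
proof (intro conjI ballI)
  show "po_system (orbit_diagram W) (orbit_less W)" by (rule orbit_po_system)
  show "disjoint_family_on (\<lambda>U. U) (orbit_diagram W)" by (rule orbit_disjoint)
  show "U \<noteq> {}" if "U \<in> orbit_diagram W" for U
    using that homeo_orbit_self by (auto simp: orbit_diagram_def)
  show "(\<Union>U\<in>orbit_diagram W. U) = topspace W"
    using homeo_orbit_self homeo_orbit_subset by (auto simp: orbit_diagram_def)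
  fix U assume "U \<in> orbit_diagram W"
  then obtain x where x: "x \<in> topspace W" "U = orbit x" by (auto simp: orbit_diagram_def)
  show "W derived_set_of U = (\<Union>V\<in>{V \<in> orbit_diagram W. orbit_less W V U}. V)"
  proof (intro equalityI subsetI)
    fix w assume w: "w \<in> W derived_set_of U"
    then have wt: "w \<in> topspace W" by (simp add: derived_set_of_def)
    then have "orbit_less W (orbit w) U" using orbit_less_iff_derived[OF wt x(1)] w x(2) by simp
    then show "w \<in> (\<Union>V\<in>{V \<in> orbit_diagram W. orbit_less W V U}. V)"
      using wt homeo_orbit_self by (intro UN_I[of "orbit w"]) (auto simp: orbit_diagram_def)
  next
    fix w assume "w \<in> (\<Union>V\<in>{V \<in> orbit_diagram W. orbit_less W V U}. V)"
    then obtain v where v: "v \<in> topspace W" "orbit_less W (orbit v) U" "w \<in> orbit v"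
      by (auto simp: orbit_diagram_def)
    have wt: "w \<in> topspace W" using v(3) homeo_orbit_subset[OF v(1)] by blast
    have "orbit_less W (orbit w) U" using homeo_orbit_eqI[OF v(1,3)] v(2) by simp
    then show "w \<in> W derived_set_of U" using orbit_less_iff_derived[OF wt x(1)] x(2) by simp
  qed
qed

lemma orbit_label:
  assumes "w \<in> topspace W"
  shows "part_label (orbit_diagram W) (\<lambda>U. U) w = orbit w"
  by (rule part_label_eq[OF orbit_disjoint _ homeo_orbit_self]) (use assms in \<open>simp add: orbit_diagram_def\<close>)

text \<open>Equivalently, \<open>types x\<close> has a greatest element. These points turn out to be those with
  separated orbit.\<close>

definition principal :: "'a \<Rightarrow> bool" where
  "principal x \<longleftrightarrow> (\<exists>A\<in>types x. \<forall>B\<in>types x. embeds A B)"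

lemma types_nonempty:
  assumes "x \<in> topspace W"
  obtains A where "A \<in> types x"
proof -
  obtain N where N: "N \<in> Co W" "x \<in> N" by (rule Co_nbhd[OF assms])
  obtain Z where "PI Z" "x \<in> Z" "Z \<subseteq> N" by (rule PI_nbhd[OF N])
  then show thesis using that types_self by blast
qed

lemma types_directed:
  assumes "A \<in> types x" "B \<in> types x"
  obtains Z where "Z \<in> types x" "embeds Z A" "embeds Z B"
proof -
  obtain Y where Y: "PI Y" "x \<in> Y" "embeds Y B" using assms(2) by (auto simp: types_def)
  obtain Z where Z: "PI Z" "x \<in> Z" "Z \<subseteq> Y" "embeds Z A"
    by (rule types_small[OF assms(1) PI_Co[OF Y(1)] Y(2)])
  have "embeds Z B" using embeds_trans[OF embeds_subset[OF PI_Co[OF Z(1)] PI_Co[OF Y(1)] Z(3)] Y(3)] .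
  then show thesis using that types_self Z by blast
qed

text \<open>By countability a directed set of types contains a cofinal increasing sequence.\<close>

lemma directed_types_realised:
  assumes D: "D \<noteq> {}" "\<And>A. A \<in> D \<Longrightarrow> PI A"
    and dir: "\<And>A B. A \<in> D \<Longrightarrow> B \<in> D \<Longrightarrow> \<exists>Z\<in>D. embeds Z A \<and> embeds Z B"
  obtains u where "u \<in> topspace W" "types u = {B. PI B \<and> (\<exists>A\<in>D. embeds A B)}"
proof -
  have "countable D" by (rule countable_subset[OF _ countable_Co]) (use D(2) PI_Co in blast)
  define d where "d = from_nat_into D"
  have d: "range d = D" using range_from_nat_into[OF D(1) \<open>countable D\<close>] by (simp add: d_def)
  have dD: "d n \<in> D" for n using d by blast
  have "\<exists>A. \<forall>n. A n \<in> D \<and> (embeds (A (Suc n)) (A n) \<and> embeds (A (Suc n)) (d n))"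
  proof (rule dependent_nat_choice)
    show "\<exists>A. A \<in> D" using D(1) by blast
    show "\<exists>Z. Z \<in> D \<and> (embeds Z A \<and> embeds Z (d n))" if "A \<in> D" for A n using dir[OF that dD[of n]] by blast
  qed
  then obtain A where A: "\<And>n. A n \<in> D" "\<And>n. embeds (A (Suc n)) (A n)" "\<And>n. embeds (A (Suc n)) (d n)" by blast
  obtain u where u: "u \<in> A 0" "types u = {B. PI B \<and> (\<exists>n. embeds (A n) B)}"
    by (rule types_limit_realised[where A = A, OF D(2)[OF A(1)] A(2)])
  have "(\<exists>n. embeds (A n) B) \<longleftrightarrow> (\<exists>A\<in>D. embeds A B)" for B
  proof
    show "\<exists>A\<in>D. embeds A B" if "\<exists>n. embeds (A n) B" using that A(1) by blast
    assume "\<exists>A\<in>D. embeds A B"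
    then obtain C where C: "C \<in> D" "embeds C B" by blast
    have "C \<in> range d" using C(1) d by simp
    then obtain n where "C = d n" by (rule rangeE)
    then show "\<exists>n. embeds (A n) B" using embeds_trans[OF A(3)[of n]] C(2) by blast
  qed
  moreover have "u \<in> topspace W" using u(1) D(2)[OF A(1)] PI_Co Co_subset_topspace by blast
  ultimately show thesis using that u(2) by simp
qed

lemma types_principal_realised:
  assumes A: "PI A"
  obtains u where "u \<in> A" "types u = {B. PI B \<and> embeds A B}"
  by (rule types_limit_realised[where A = "\<lambda>_. A"])
    (use A embeds_subset PI_Co in auto)

text \<open>The types of a neighbourhood base of \<open>x\<close> can be made strictly increasing. Realising each of them by
  a point yields a strictly increasing sequence of orbits with supremum the orbit of \<open>x\<close>.\<close>

lemma not_principal_imp_not_separated: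
  assumes x: "x \<in> topspace W" and np: "\<not> principal x"
  shows "\<not> separated_in (orbit_diagram W) (orbit_less W) (orbit x)"
proof -
  obtain N where N: "\<And>n. N n \<in> Co W" "\<And>n. x \<in> N n" "\<And>n. N (Suc n) \<subseteq> N n"
    "\<And>U. openin W U \<Longrightarrow> x \<in> U \<Longrightarrow> \<exists>n. N n \<subseteq> U"
    using Co_nbhd_seq[OF x] by metis
  have "\<exists>A. \<forall>n. (PI (A n) \<and> x \<in> A n) \<and> (A (Suc n) \<subseteq> A n \<and> A (Suc n) \<subseteq> N n \<and> \<not> embeds (A n) (A (Suc n)))"
  proof (rule dependent_nat_choice)
    obtain Z where "PI Z" "x \<in> Z" "Z \<subseteq> N 0" by (rule PI_nbhd[OF N(1,2)])
    then show "\<exists>A. PI A \<and> x \<in> A" by blast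
    fix A n assume A: "PI A \<and> x \<in> A"
    then have "A \<in> types x" using types_self by blast
    then obtain B where B: "B \<in> types x" "\<not> embeds A B" using np unfolding principal_def by blast
    have "A \<inter> N n \<in> Co W" "x \<in> A \<inter> N n" using Co_Int PI_Co A N(1,2) by auto
    then obtain Z where Z: "PI Z" "x \<in> Z" "Z \<subseteq> A \<inter> N n" "embeds Z B"
      by (rule types_small[OF B(1)])
    then have "\<not> embeds A Z" using embeds_trans B(2) by blast
    then show "\<exists>Z. (PI Z \<and> x \<in> Z) \<and> (Z \<subseteq> A \<and> Z \<subseteq> N n \<and> \<not> embeds A Z)" using Z by blast
  qed
  then obtain A where A: "\<And>n. PI (A n)" "\<And>n. x \<in> A n" "\<And>n. A (Suc n) \<subseteq> A n" "\<And>n. A (Suc n) \<subseteq> N n"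
    "\<And>n. \<not> embeds (A n) (A (Suc n))" by blast
  have "\<exists>u. u \<in> topspace W \<and> types u = {B. PI B \<and> embeds (A n) B}" for n
  proof -
    obtain u where "u \<in> A n" "types u = {B. PI B \<and> embeds (A n) B}"
      by (rule types_principal_realised[OF A(1)])
    then show ?thesis using Co_subset_topspace[OF PI_Co[OF A(1)]] by blast
  qed
  then obtain u where u: "\<And>n. u n \<in> topspace W" "\<And>n. types (u n) = {B. PI B \<and> embeds (A n) B}" by metis
  have sub: "A j \<subseteq> A i" if "i \<le> j" for i j using A(3) that by (rule lift_Suc_antimono_le)
  have em: "embeds (A j) (A i)" if "i \<le> j" for i j using embeds_subset PI_Co A(1) sub that by blast
  let ?s = "\<lambda>n. orbit (u n)"
  have "range ?s \<subseteq> orbit_diagram W" using u(1) by (auto simp: orbit_diagram_def)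
  moreover have "strictly_increasing (orbit_less W) ?s"
    unfolding strictly_increasing_def
  proof (rule monotoneI)
    fix i j :: nat assume ij: "i < j"
    have "types (u i) \<subseteq> types (u j)" using em[of i j] ij embeds_trans u(2) by auto
    moreover have "\<not> embeds (A i) (A j)"
      using A(5)[of i] em[of "Suc i" j] ij embeds_trans by (meson Suc_leI)
    then have "A j \<in> types (u j)" "A j \<notin> types (u i)" using u(2) A(1) em[of j j] by auto
    ultimately show "po_lneq (orbit_less W) (?s i) (?s j)" using orbit_lneq_iff[OF u(1) u(1)] by blast
  qed
  moreover have "is_supremum (orbit_diagram W) (orbit_less W) (range ?s) (orbit x)"
    unfolding is_supremum_def
  proof (intro conjI ballI impI)
    show "orbit x \<in> orbit_diagram W" using x by (simp add: orbit_diagram_def)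
    fix s assume "s \<in> range ?s"
    then obtain n where n: "s = orbit (u n)" by blast
    have "types (u n) \<subseteq> types x" using u(2) types_up[OF types_self[OF A(1,2)]] by auto
    then show "s \<sqsubseteq> orbit x" using orbit_le_iff[OF u(1) x] n by simp
  next
    fix V assume "V \<in> orbit_diagram W" and ub: "\<forall>s\<in>range ?s. s \<sqsubseteq> V"
    then obtain v where v: "v \<in> topspace W" "V = orbit v" by (auto simp: orbit_diagram_def)
    have "types x \<subseteq> types v"
    proof
      fix B assume "B \<in> types x"
      then obtain Z where Z: "PI B" "PI Z" "x \<in> Z" "embeds Z B" by (auto simp: types_def)
      obtain n where "N n \<subseteq> Z" using N(4)[OF Co_openin[OF PI_Co[OF Z(2)]] Z(3)] by blast
      then have "A (Suc n) \<subseteq> Z" using A(4) by blast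
      then have "embeds (A (Suc n)) B" using embeds_trans embeds_subset PI_Co A(1) Z(2,4) by blast
      then have "B \<in> types (u (Suc n))" using u(2) Z(1) by simp
      moreover have "orbit (u (Suc n)) \<sqsubseteq> orbit v" using ub v(2) by blast
      then have "types (u (Suc n)) \<subseteq> types v" using orbit_le_iff[OF u(1) v(1)] by simp
      ultimately show "B \<in> types v" by blast
    qed
    then show "orbit x \<sqsubseteq> V" using orbit_le_iff[OF x v(1)] v(2) by simp
  qed
  ultimately have "\<exists>s :: nat \<Rightarrow> 'a set. range s \<subseteq> orbit_diagram W \<and> strictly_increasing (orbit_less W) s \<and>
      is_supremum (orbit_diagram W) (orbit_less W) (range s) (orbit x)" by (intro exI[of _ ?s] conjI)
  then show ?thesis unfolding separated_in_def by simp
qed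

text \<open>Let the orbit of \<open>x\<close> be the supremum of a strictly increasing sequence. The union of the
  corresponding sets of local types is directed, hence realised by a point \<open>v\<close>, whose orbit is an
  upper bound and therefore lies above the orbit of \<open>x\<close>. So the greatest type at \<open>x\<close> occurs already at some
  member of the sequence, which is impossible as later members are strictly larger.\<close>

lemma principal_imp_separated:
  assumes x: "x \<in> topspace W" and pr: "principal x"
  shows "separated_in (orbit_diagram W) (orbit_less W) (orbit x)"
  unfolding separated_in_def
proof (intro conjI notI)
  show "orbit x \<in> orbit_diagram W" using x by (simp add: orbit_diagram_def)
  assume "\<exists>s :: nat \<Rightarrow> 'a set. range s \<subseteq> orbit_diagram W \<and> strictly_increasing (orbit_less W) s \<and>
      is_supremum (orbit_diagram W) (orbit_less W) (range s) (orbit x)"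
  then obtain s :: "nat \<Rightarrow> 'a set" where s: "range s \<subseteq> orbit_diagram W" "strictly_increasing (orbit_less W) s"
    "is_supremum (orbit_diagram W) (orbit_less W) (range s) (orbit x)" by blast
  have "\<forall>n. \<exists>z. z \<in> topspace W \<and> s n = orbit z" using s(1) by (auto simp: orbit_diagram_def)
  then obtain z where z: "\<And>n. z n \<in> topspace W" "\<And>n. s n = orbit (z n)" by metis
  obtain A where A: "A \<in> types x" "\<And>B. B \<in> types x \<Longrightarrow> embeds A B" using pr unfolding principal_def by blast
  have incr: "types (z i) \<subset> types (z j)" if "i < j" for i j
    using s(2) that orbit_lneq_iff[OF z(1) z(1)] z(2)
    unfolding strictly_increasing_def monotone_on_def by auto
  have mono: "types (z i) \<subseteq> types (z j)" if "i \<le> j" for i j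
    using incr[of i j] that by (cases "i = j") auto
  have ub: "types (z n) \<subseteq> types x" for n
    using s(3) orbit_le_iff[OF z(1) x] z(2) unfolding is_supremum_def by (metis rangeI)
  let ?D = "\<Union>n. types (z n)"
  have "A \<notin> types (z n)" for n
  proof
    assume "A \<in> types (z n)"
    then have "types x \<subseteq> types (z n)" using A(2) types_up types_PI by blast
    then show False using incr[of n "Suc n"] ub[of "Suc n"] by blast
  qed
  moreover obtain v where v: "v \<in> topspace W" "types v = {B. PI B \<and> (\<exists>A\<in>?D. embeds A B)}"
  proof (rule directed_types_realised)
    obtain B where "B \<in> types (z 0)" by (rule types_nonempty[OF z(1)])
    then show "?D \<noteq> {}" by blast
    show "PI A" if "A \<in> ?D" for A using that types_PI by blast
    fix A B assume "A \<in> ?D" "B \<in> ?D"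
    then obtain i j where "A \<in> types (z i)" "B \<in> types (z j)" by blast
    then have "A \<in> types (z (max i j))" "B \<in> types (z (max i j))"
      using mono[of i "max i j"] mono[of j "max i j"] by auto
    then obtain Z where "Z \<in> types (z (max i j))" "embeds Z A" "embeds Z B" by (rule types_directed)
    then show "\<exists>Z\<in>?D. embeds Z A \<and> embeds Z B" by blast
  qed
  moreover have "types v = ?D"
    unfolding v(2) using types_up types_PI embeds_subset PI_Co by blast
  moreover have "orbit x \<sqsubseteq> orbit v"
  proof -
    have "\<forall>t\<in>range s. t \<sqsubseteq> orbit v"
    proof
      fix t assume "t \<in> range s"
      then obtain n where n: "t = orbit (z n)" using z(2) by blast
      have "types (z n) \<subseteq> types v" using \<open>types v = ?D\<close> by blast
      then show "t \<sqsubseteq> orbit v" using orbit_le_iff[OF z(1) v(1)] n by simp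
    qed
    moreover have "orbit v \<in> orbit_diagram W" using v(1) by (simp add: orbit_diagram_def)
    ultimately show ?thesis using s(3) unfolding is_supremum_def by blast
  qed
  then have "A \<in> types v" using orbit_le_iff[OF x v(1)] A(1) by blast
  ultimately show False by blast
qed

text \<open>For separated \<open>q\<close>, being above \<open>q\<close> means having the greatest type of \<open>q\<close> among the local types,
  and this is an open condition. At a point \<open>x\<close> whose orbit is not separated, each neighbourhood
  \<open>Z\<close> of \<open>x\<close> contains a point with greatest type \<open>Z\<close>, which is strictly below \<open>x\<close>.\<close>

theorem orbit_diagram_rank: "orbit_diagram_rank_partition W"
  unfolding orbit_diagram_rank_partition_def rank_partition_def
proof (intro conjI)
  let ?P = "orbit_diagram W" and ?lt = "orbit_less W"
  let ?t = "part_label ?P (\<lambda>U. U)"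
  show "complete_partition W ?P ?lt (\<lambda>U. U)" by (rule orbit_complete_partition)
  show "RP1 W ?P ?lt ?t"
    unfolding RP1_def
  proof (intro allI impI, elim conjE)
    fix q x and xs :: "nat \<Rightarrow> 'a"
    assume sep: "separated_in ?P ?lt q" and x: "x \<in> topspace W" and xs: "range xs \<subseteq> topspace W"
      and lim: "limitin W xs x sequentially" and qx: "q \<sqsubseteq> ?t x"
    obtain y where y: "y \<in> topspace W" "q = orbit y"
      using sep by (auto simp: separated_in_def orbit_diagram_def)
    have "principal y" using not_principal_imp_not_separated[OF y(1)] sep y(2) by blast
    then obtain A where A: "A \<in> types y" "\<And>B. B \<in> types y \<Longrightarrow> embeds A B" unfolding principal_def by blast
    have "types y \<subseteq> types x" using qx orbit_label[OF x] orbit_le_iff[OF y(1) x] y(2) by simp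
    then obtain Z where Z: "PI Z" "x \<in> Z" "embeds Z A" using A(1) by (auto simp: types_def)
    have "\<forall>\<^sub>F k in sequentially. xs k \<in> Z"
      using lim Co_openin[OF PI_Co[OF Z(1)]] Z(2) unfolding limitin_def by blast
    then show "\<forall>\<^sub>F k in sequentially. q \<sqsubseteq> ?t (xs k)"
    proof (rule eventually_mono)
      fix k assume k: "xs k \<in> Z"
      have kt: "xs k \<in> topspace W" using xs by blast
      have "A \<in> types (xs k)" using types_up[OF types_self[OF Z(1) k] types_PI[OF A(1)] Z(3)] .
      then have "types y \<subseteq> types (xs k)" using A(2) types_up types_PI by blast
      then show "q \<sqsubseteq> ?t (xs k)" using orbit_label[OF kt] orbit_le_iff[OF y(1) kt] y(2) by simp
    qed
  qed
  show "RP2 W ?P ?lt ?t"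
    unfolding RP2_def
  proof (intro ballI impI)
    fix x assume x: "x \<in> topspace W" and ns: "\<not> separated_in ?P ?lt (?t x)"
    have np: "\<not> principal x" using principal_imp_separated[OF x] ns orbit_label[OF x] by auto
    obtain N where N: "\<And>n. N n \<in> Co W" "\<And>n. x \<in> N n" "\<And>n. N (Suc n) \<subseteq> N n"
      "\<And>U. openin W U \<Longrightarrow> x \<in> U \<Longrightarrow> \<exists>n. N n \<subseteq> U"
      using Co_nbhd_seq[OF x] by metis
    have "\<exists>u. u \<in> N n \<and> types u \<subset> types x" for n
    proof -
      obtain Z where Z: "PI Z" "x \<in> Z" "Z \<subseteq> N n" by (rule PI_nbhd[OF N(1,2)])
      obtain u where u: "u \<in> Z" "types u = {B. PI B \<and> embeds Z B}" by (rule types_principal_realised[OF Z(1)])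
      have Zx: "Z \<in> types x" using types_self Z by blast
      then have "types u \<subseteq> types x" using u(2) types_up by blast
      moreover have "types u \<noteq> types x" using np u(2) Zx unfolding principal_def by blast
      ultimately show ?thesis using u(1) Z(3) by blast
    qed
    then obtain u where u: "\<And>n. u n \<in> N n" "\<And>n. types (u n) \<subset> types x" by metis
    have ut: "u n \<in> topspace W" for n using u(1) Co_subset_topspace[OF N(1)] by blast
    have "limitin W u x sequentially" by (rule limitin_nbhd_seq[OF x N(3,4) u(1)])
    moreover have "po_lneq ?lt (?t (u k)) (?t x)" for k
      using orbit_lneq_iff[OF ut x] u(2) orbit_label[OF x] orbit_label[OF ut] by simp
    ultimately show "\<exists>xs. range xs \<subseteq> topspace W \<and> limitin W xs x sequentially \<and>
        (\<forall>k. po_lneq ?lt (?t (xs k)) (?t x))" using ut by blast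
  qed
qed

end

theorem corollary4p25:
  fixes W :: "'a topology"
  assumes "omega_stone_space W"
  shows "(primitive_space W \<longleftrightarrow> admits_rank_partition W) \<and>
         (admits_rank_partition W \<longleftrightarrow> orbit_diagram_rank_partition W)"
proof -
  have os: "omega_stone W" using assms by (rule omega_stone.intro)
  have "orbit_diagram_rank_partition W" if "primitive_space W"
    using primitive_stone.orbit_diagram_rank[of W] os that
    by (simp add: primitive_stone_def primitive_stone_axioms_def)
  moreover have "primitive_space W" if adm: "admits_rank_partition W"
  proof -
    obtain P :: "'a set set" and lt X where "rank_partition W P lt X"
      using adm unfolding admits_rank_partition_def by blast
    then have "rank_partitioned W P lt X"
      using os by (simp add: rank_partitioned_def rank_partitioned_axioms_def)
    then show ?thesis by (rule rank_partitioned.rank_partition_imp_primitive)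
  qed
  moreover have "admits_rank_partition W" if "orbit_diagram_rank_partition W"
    using that unfolding orbit_diagram_rank_partition_def admits_rank_partition_def by blast
  ultimately show ?thesis by blast
qed

end
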